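(* Let $\mathbf{E}\subseteq\mathbf{A}\in\mathsf{NA}$ (with $\mathbf{E}$ a subalgebra of $\mathbf{A}$), where: $\mathbf{E}$ is finite and symmetric, $1'$ is an atom of $\mathbf{E}$, and $\mathbf{E}$ has $p>3$ atoms; $\mathbf{E}$ has no 1-cycles, i.e., $u;u\cdot u=0$ for every atom $u\le 0'$ of $\mathbf{E}$; $\mathbf{A}$ is finite and symmetric, $1'$ is an atom of $\mathbf{A}$, and some diversity atom of $\mathbf{E}$ is the join of at least $p^{p-1}$ atoms of $\mathbf{A}$. Then (i) $\mathbf{A}\notin\mathbf{S}\,\mathsf{Ra}\,\mathsf{CA}_{p+1}$; (ii) $\mathbf{Ca}(B_3(\mathbf{A}))\notin\mathbf{S}\,\mathsf{Nr}_3\mathsf{CA}_{p+1}$.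
   Context: $\mathsf{NA}$ is the class of non-associative relation algebras (Tarski's relation algebra axioms without associativity of relative product $;$); $1'$ is the identity element, $0'$ its Boolean complement; symmetric means $x^{\smile}=x$ for all $x$; a diversity atom is an atom below $0'$. Basic matrices: for an atomic $\mathbf{A}\in\mathsf{NA}$ and $k<\omega$, $B_k(\mathbf{A})$ is the set of maps $\mu:k\times k\to At(\mathbf{A})$ with $\mu_{i,i}\le1'$, $\mu_{i,j}^{\smile}=\mu_{j,i}$ and $\mu_{i,l};\mu_{l,j}\ge\mu_{i,j}$ for all $i,j,l<k$. For $\mathcal{M}\subseteq B_k(\mathbf{A})$, $\mathbf{Ca}(\mathcal{M})$ is the algebra of all subsets of $\mathcal{M}$ with set Boolean operations, cylindrifications $c_iX=\{\mu\in\mathcal{M}:\exists\mu'\in X$ with $\mu_{l,m}=\mu'_{l,m}$ whenever $l,m\ne i\}$ and diagonal elements $d_{ij}=\{\mu\in\mathcal{M}:\mu_{i,j}\le1'\}$, for $i,j<k$. Cylindric algebras: $\mathsf{CA}_m$ is the class of $m$-dimensional cylindric algebras (Henkin–Monk–Tarski); $s^i_jx=c_i(d_{ij}\cdot x)$ for $i\ne j$. For $\mathbf{D}\in\mathsf{CA}_m$ and $n\le m$, $\mathsf{Nr}_n\mathbf{D}$ (neat $n$-reduct) is the algebra of all $x$ with $c_ix=x$ for $n\le i<m$, with the Boolean operations and $c_i,d_{ij}$ for $i,j<n$. For $\mathbf{D}\in\mathsf{CA}_m$ with $m\ge3$, $\mathbf{Ra}(\mathbf{D})$ has universe $\{x:c_ix=x$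 for $2\le i<m\}$, the Boolean operations of $\mathbf{D}$, $1'=d_{01}$, $x^{\smile}=s^2_0s^0_1s^1_2x$, $x;y=c_2(s^1_2x\cdot s^0_2y)$. $\mathsf{Ra}\,\mathsf{CA}_m$ is the class of algebras isomorphic to $\mathbf{Ra}(\mathbf{D})$ for some subalgebra $\mathbf{D}$ of $\mathsf{Nr}_3\mathbf{D}'$ with $\mathbf{D}'\in\mathsf{CA}_m$. For a class $\mathsf{K}$, $\mathbf{S}\,\mathsf{K}$ is the class of algebras isomorphic to subalgebras of members of $\mathsf{K}$; thus $\mathbf{S}\,\mathsf{Nr}_3\mathsf{CA}_m$ is the class of algebras isomorphic to subalgebras of $\mathsf{Nr}_3\mathbf{D}$ for $\mathbf{D}\in\mathsf{CA}_m$. *)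

theory Defs
  imports "HOL-Library.FuncSet"
begin

record 'a ra_alg =
  ra_carrier :: "'a set"
  ra_plus :: "'a \<Rightarrow> 'a \<Rightarrow> 'a"
  ra_cmp :: "'a \<Rightarrow> 'a"
  ra_comp :: "'a \<Rightarrow> 'a \<Rightarrow> 'a"
  ra_conv :: "'a \<Rightarrow> 'a"
  ra_ident :: "'a"

definition ra_meet :: "('a, 'm) ra_alg_scheme \<Rightarrow> 'a \<Rightarrow> 'a \<Rightarrow> 'a" where
  "ra_meet A x y = ra_cmp A (ra_plus A (ra_cmp A x) (ra_cmp A y))"

definition ra_zero :: "('a, 'm) ra_alg_scheme \<Rightarrow> 'a" where
  "ra_zero A = ra_cmp A (ra_plus A (ra_ident A) (ra_cmp A (ra_ident A)))"

definition ra_diversity :: "('a, 'm) ra_alg_scheme \<Rightarrow> 'a" where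
  "ra_diversity A = ra_cmp A (ra_ident A)"

definition ra_le :: "('a, 'm) ra_alg_scheme \<Rightarrow> 'a \<Rightarrow> 'a \<Rightarrow> bool" where
  "ra_le A x y \<longleftrightarrow> ra_plus A x y = y"

text \<open>Tarski's axioms R1--R3, R5--R10 (i.e. all except associativity R4 of ;).\<close>
definition is_NA :: "('a, 'm) ra_alg_scheme \<Rightarrow> bool" where
  "is_NA A \<longleftrightarrow>
     ra_carrier A \<noteq> {} \<and>
     (\<forall>x\<in>ra_carrier A. \<forall>y\<in>ra_carrier A.
        ra_plus A x y \<in> ra_carrier A \<and> ra_comp A x y \<in> ra_carrier A) \<and>
     (\<forall>x\<in>ra_carrier A. ra_cmp A x \<in> ra_carrier A \<and> ra_conv A x \<in> ra_carrier A) \<and>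
     ra_ident A \<in> ra_carrier A \<and>
     (\<forall>x\<in>ra_carrier A. \<forall>y\<in>ra_carrier A. \<forall>z\<in>ra_carrier A.
        ra_plus A x y = ra_plus A y x \<and>
        ra_plus A x (ra_plus A y z) = ra_plus A (ra_plus A x y) z \<and>
        ra_plus A (ra_cmp A (ra_plus A (ra_cmp A x) y))
                  (ra_cmp A (ra_plus A (ra_cmp A x) (ra_cmp A y))) = x \<and>
        ra_comp A (ra_plus A x y) z = ra_plus A (ra_comp A x z) (ra_comp A y z) \<and>
        ra_comp A x (ra_ident A) = x \<and>
        ra_conv A (ra_conv A x) = x \<and>
        ra_conv A (ra_plus A x y) = ra_plus A (ra_conv A x) (ra_conv A y) \<and>
        ra_conv A (ra_comp A x y) = ra_comp A (ra_conv A y) (ra_conv A x) \<and>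
        ra_plus A (ra_comp A (ra_conv A x) (ra_cmp A (ra_comp A x y))) (ra_cmp A y)
          = ra_cmp A y)"

definition ra_atoms_in :: "('a, 'm) ra_alg_scheme \<Rightarrow> 'a set \<Rightarrow> 'a set" where
  "ra_atoms_in A S = {x \<in> S. x \<noteq> ra_zero A \<and>
      (\<forall>y\<in>S. ra_le A y x \<longrightarrow> y = ra_zero A \<or> y = x)}"

abbreviation ra_atoms :: "('a, 'm) ra_alg_scheme \<Rightarrow> 'a set" where
  "ra_atoms A \<equiv> ra_atoms_in A (ra_carrier A)"

definition is_subuniverse :: "('a, 'm) ra_alg_scheme \<Rightarrow> 'a set \<Rightarrow> bool" where
  "is_subuniverse A E \<longleftrightarrow> E \<subseteq> ra_carrier A \<and> ra_ident A \<in> E \<and>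
     (\<forall>x\<in>E. \<forall>y\<in>E. ra_plus A x y \<in> E \<and> ra_comp A x y \<in> E) \<and>
     (\<forall>x\<in>E. ra_cmp A x \<in> E \<and> ra_conv A x \<in> E)"

definition symmetric_on :: "('a, 'm) ra_alg_scheme \<Rightarrow> 'a set \<Rightarrow> bool" where
  "symmetric_on A S \<longleftrightarrow> (\<forall>x\<in>S. ra_conv A x = x)"

record 'b ca_alg =
  ca_carrier :: "'b set"
  ca_plus :: "'b \<Rightarrow> 'b \<Rightarrow> 'b"
  ca_cmp :: "'b \<Rightarrow> 'b"
  ca_cyl :: "nat \<Rightarrow> 'b \<Rightarrow> 'b"
  ca_diag :: "nat \<Rightarrow> nat \<Rightarrow> 'b"

definition ca_meet :: "('b, 'm) ca_alg_scheme \<Rightarrow> 'b \<Rightarrow> 'b \<Rightarrow> 'b" where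
  "ca_meet D x y = ca_cmp D (ca_plus D (ca_cmp D x) (ca_cmp D y))"

definition ca_zero :: "('b, 'm) ca_alg_scheme \<Rightarrow> 'b" where
  "ca_zero D = ca_cmp D (ca_plus D (ca_diag D 0 0) (ca_cmp D (ca_diag D 0 0)))"

definition ca_top :: "('b, 'm) ca_alg_scheme \<Rightarrow> 'b" where
  "ca_top D = ca_plus D (ca_diag D 0 0) (ca_cmp D (ca_diag D 0 0))"

definition ca_le :: "('b, 'm) ca_alg_scheme \<Rightarrow> 'b \<Rightarrow> 'b \<Rightarrow> bool" where
  "ca_le D x y \<longleftrightarrow> ca_plus D x y = y"

text \<open>Henkin--Monk--Tarski axioms (C0)--(C7) for dimension \<open>m\<close> (indices \<open>< m\<close>);
  Boolean algebra via Huntington's axioms.\<close>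
definition is_CA :: "nat \<Rightarrow> ('b, 'm) ca_alg_scheme \<Rightarrow> bool" where
  "is_CA m D \<longleftrightarrow>
     0 < m \<and> ca_carrier D \<noteq> {} \<and>
     (\<forall>x\<in>ca_carrier D. \<forall>y\<in>ca_carrier D. ca_plus D x y \<in> ca_carrier D) \<and>
     (\<forall>x\<in>ca_carrier D. ca_cmp D x \<in> ca_carrier D) \<and>
     (\<forall>i<m. \<forall>x\<in>ca_carrier D. ca_cyl D i x \<in> ca_carrier D) \<and>
     (\<forall>i<m. \<forall>j<m. ca_diag D i j \<in> ca_carrier D) \<and>
     (\<forall>x\<in>ca_carrier D. \<forall>y\<in>ca_carrier D. \<forall>z\<in>ca_carrier D.
        ca_plus D x y = ca_plus D y x \<and>
        ca_plus D x (ca_plus D y z) = ca_plus D (ca_plus D x y) z \<and>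
        ca_plus D (ca_cmp D (ca_plus D (ca_cmp D x) y))
                  (ca_cmp D (ca_plus D (ca_cmp D x) (ca_cmp D y))) = x) \<and>
     (\<forall>i<m. ca_cyl D i (ca_zero D) = ca_zero D) \<and>
     (\<forall>i<m. \<forall>x\<in>ca_carrier D. ca_le D x (ca_cyl D i x)) \<and>
     (\<forall>i<m. \<forall>x\<in>ca_carrier D. \<forall>y\<in>ca_carrier D.
        ca_cyl D i (ca_meet D x (ca_cyl D i y)) = ca_meet D (ca_cyl D i x) (ca_cyl D i y)) \<and>
     (\<forall>i<m. \<forall>j<m. \<forall>x\<in>ca_carrier D. ca_cyl D i (ca_cyl D j x) = ca_cyl D j (ca_cyl D i x)) \<and>
     (\<forall>i<m. ca_diag D i i = ca_top D) \<and>
     (\<forall>i<m. \<forall>j<m. \<forall>k<m. k \<noteq> i \<and> k \<noteq> j \<longrightarrow>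
        ca_diag D i j = ca_cyl D k (ca_meet D (ca_diag D i k) (ca_diag D k j))) \<and>
     (\<forall>i<m. \<forall>j<m. \<forall>x\<in>ca_carrier D. i \<noteq> j \<longrightarrow>
        ca_meet D (ca_cyl D i (ca_meet D (ca_diag D i j) x))
                  (ca_cyl D i (ca_meet D (ca_diag D i j) (ca_cmp D x))) = ca_zero D)"

definition ca_subst :: "('b, 'm) ca_alg_scheme \<Rightarrow> nat \<Rightarrow> nat \<Rightarrow> 'b \<Rightarrow> 'b" where
  "ca_subst D i j x = ca_cyl D i (ca_meet D (ca_diag D i j) x)"

definition nr_carrier :: "nat \<Rightarrow> nat \<Rightarrow> ('b, 'm) ca_alg_scheme \<Rightarrow> 'b set" where
  "nr_carrier n m D = {x \<in> ca_carrier D. \<forall>i. n \<le> i \<and> i < m \<longrightarrow> ca_cyl D i x = x}"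

definition sub_nr3 :: "nat \<Rightarrow> ('b, 'm) ca_alg_scheme \<Rightarrow> 'b set \<Rightarrow> bool" where
  "sub_nr3 m D S \<longleftrightarrow> S \<subseteq> nr_carrier 3 m D \<and>
     (\<forall>x\<in>S. \<forall>y\<in>S. ca_plus D x y \<in> S) \<and> (\<forall>x\<in>S. ca_cmp D x \<in> S) \<and>
     (\<forall>i<3. \<forall>x\<in>S. ca_cyl D i x \<in> S) \<and> (\<forall>i<3. \<forall>j<3. ca_diag D i j \<in> S)"

definition Ra_conv :: "('b, 'm) ca_alg_scheme \<Rightarrow> 'b \<Rightarrow> 'b" where
  "Ra_conv D x = ca_subst D 2 0 (ca_subst D 0 1 (ca_subst D 1 2 x))"

definition Ra_comp :: "('b, 'm) ca_alg_scheme \<Rightarrow> 'b \<Rightarrow> 'b \<Rightarrow> 'b" where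
  "Ra_comp D x y = ca_cyl D 2 (ca_meet D (ca_subst D 1 2 x) (ca_subst D 0 2 y))"

text \<open>\<open>h\<close> is an embedding (injective homomorphism) of \<open>A\<close> into \<open>Ra(S)\<close>, where the
  universe of \<open>Ra(S)\<close> is \<open>{x \<in> S. c_2 x = x}\<close> (here \<open>S\<close> is 3-dimensional).\<close>
definition embeds_into_Ra :: "('a, 'm) ra_alg_scheme \<Rightarrow> ('b, 'n) ca_alg_scheme \<Rightarrow> 'b set
    \<Rightarrow> ('a \<Rightarrow> 'b) \<Rightarrow> bool" where
  "embeds_into_Ra A D S h \<longleftrightarrow>
     inj_on h (ra_carrier A) \<and>
     (\<forall>x\<in>ra_carrier A. h x \<in> S \<and> ca_cyl D 2 (h x) = h x) \<and>
     (\<forall>x\<in>ra_carrier A. \<forall>y\<in>ra_carrier A.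
        h (ra_plus A x y) = ca_plus D (h x) (h y) \<and>
        h (ra_comp A x y) = Ra_comp D (h x) (h y)) \<and>
     (\<forall>x\<in>ra_carrier A. h (ra_cmp A x) = ca_cmp D (h x) \<and>
        h (ra_conv A x) = Ra_conv D (h x)) \<and>
     h (ra_ident A) = ca_diag D 0 1"

definition in_S_Ra_CA :: "nat \<Rightarrow> ('a, 'm) ra_alg_scheme \<Rightarrow> 'b itself \<Rightarrow> bool" where
  "in_S_Ra_CA m A _ \<longleftrightarrow>
     (\<exists>(D :: 'b ca_alg) S h. is_CA m D \<and> sub_nr3 m D S \<and> embeds_into_Ra A D S h)"

definition in_S_Nr3_CA :: "nat \<Rightarrow> ('c, 'm) ca_alg_scheme \<Rightarrow> 'b itself \<Rightarrow> bool" where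
  "in_S_Nr3_CA m B _ \<longleftrightarrow>
     (\<exists>(D :: 'b ca_alg) h. is_CA m D \<and>
        inj_on h (ca_carrier B) \<and>
        (\<forall>x\<in>ca_carrier B. h x \<in> nr_carrier 3 m D) \<and>
        (\<forall>x\<in>ca_carrier B. \<forall>y\<in>ca_carrier B. h (ca_plus B x y) = ca_plus D (h x) (h y)) \<and>
        (\<forall>x\<in>ca_carrier B. h (ca_cmp B x) = ca_cmp D (h x)) \<and>
        (\<forall>i<3. \<forall>x\<in>ca_carrier B. h (ca_cyl B i x) = ca_cyl D i (h x)) \<and>
        (\<forall>i<3. \<forall>j<3. h (ca_diag B i j) = ca_diag D i j))"

definition basic_matrices :: "('a, 'm) ra_alg_scheme \<Rightarrow> nat \<Rightarrow> (nat \<times> nat \<Rightarrow> 'a) set" where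
  "basic_matrices A k =
     {\<mu> \<in> ({0..<k} \<times> {0..<k}) \<rightarrow>\<^sub>E ra_atoms A.
        (\<forall>i<k. ra_le A (\<mu> (i, i)) (ra_ident A)) \<and>
        (\<forall>i<k. \<forall>j<k. ra_conv A (\<mu> (i, j)) = \<mu> (j, i)) \<and>
        (\<forall>i<k. \<forall>j<k. \<forall>l<k. ra_le A (\<mu> (i, j)) (ra_comp A (\<mu> (i, l)) (\<mu> (l, j))))}"

definition Ca :: "('a, 'm) ra_alg_scheme \<Rightarrow> nat \<Rightarrow> (nat \<times> nat \<Rightarrow> 'a) set
    \<Rightarrow> (nat \<times> nat \<Rightarrow> 'a) set ca_alg" where
  "Ca A k M =
     \<lparr> ca_carrier = Pow M,
       ca_plus = (\<lambda>X Y. X \<union> Y),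
       ca_cmp = (\<lambda>X. M - X),
       ca_cyl = (\<lambda>i X. {\<mu> \<in> M. \<exists>\<mu>'\<in>X. \<forall>l<k. \<forall>m<k. l \<noteq> i \<and> m \<noteq> i \<longrightarrow> \<mu> (l, m) = \<mu>' (l, m)}),
       ca_diag = (\<lambda>i j. {\<mu> \<in> M. ra_le A (\<mu> (i, j)) (ra_ident A)}) \<rparr>"

end

theory Submission
  imports Defs
begin

text \<open>
  By Stone duality a cylindric algebra \<open>D\<close> of dimension \<open>p + 1\<close> may be taken to be a field of
  sets, so an embedding of \<open>A\<close> into \<open>Ra\<close> turns elements of \<open>A\<close> into labels on pairs of
  coordinates, with the relative product available at any \<open>i < j\<close> through any free third
  coordinate. If the diversity atom \<open>u\<close> of \<open>E\<close> splits into at least \<open>p ^ (p - 1)\<close> atoms of \<open>A\<close>,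
  then over any point there are that many distinct neighbours joined to it by \<open>u\<close>. As in the
  proof of Ramsey's theorem for triangles, one repeatedly fixes a neighbour as the next point and
  keeps those remaining neighbours whose edges to it have the most popular of the \<open>p - 1\<close>
  diversity colours; only one spare coordinate is needed for all the neighbours still waiting.
  The \<open>p\<close> colours arising this way are pairwise distinct because \<open>E\<close> has no 1-cycles, which is
  one colour too many. Part (ii) reduces to part (i): \<open>A\<close> embeds into
  \<open>Ra(Ca(B_3(A)))\<close> via \<open>a \<mapsto> {\<mu>. \<mu>(0,1) \<le> a}\<close>.
\<close>

section \<open>Stone representation of Huntington algebras\<close>

text \<open>The threshold p^(p-1) is the price of p - 1 rounds of selection. A round spends one
  neighbour as the new point and splits the others among at most p - 1 colours, so p^(e+1)
  neighbours leave at least p^e, and one must survive to occupy coordinate p. Points 0, ..., p - 1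
  and this last one exhaust the p + 1 coordinates. If \<open>col i\<close> and \<open>col j\<close>
  agreed, the triangle i, j, p would have a single colour. The obstacle is that \<open>D\<close>
  need not be representable by sets of sequences: a point of its Stone space is not a tuple, and
  there are far more waiting neighbours than coordinates. A waiting neighbour is therefore only a
  condition \<open>x \<subseteq> c p (...)\<close>, and all these conditions bind the same
  coordinate p. The colour of an edge between a new point and a waiting neighbour may vary over
  \<open>x\<close>, so it is chosen at one Stone point and \<open>x\<close> is shrunk around that
  point. Symmetry makes labels on increasing pairs sufficient, so no coordinate is spent on forming
  converses.\<close>

locale huntington =
  fixes C :: "'a set" and plus :: "'a \<Rightarrow> 'a \<Rightarrow> 'a" (infixl "\<oplus>" 65) and neg :: "'a \<Rightarrow> 'a"
  assumes nonempty: "C \<noteq> {}"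
    and plus_closed [simp]: "\<lbrakk>x \<in> C; y \<in> C\<rbrakk> \<Longrightarrow> x \<oplus> y \<in> C"
    and neg_closed [simp]: "x \<in> C \<Longrightarrow> neg x \<in> C"
    and comm: "\<lbrakk>x \<in> C; y \<in> C\<rbrakk> \<Longrightarrow> x \<oplus> y = y \<oplus> x"
    and assoc: "\<lbrakk>x \<in> C; y \<in> C; z \<in> C\<rbrakk> \<Longrightarrow> x \<oplus> y \<oplus> z = x \<oplus> (y \<oplus> z)"
    and axiom: "\<lbrakk>x \<in> C; y \<in> C\<rbrakk> \<Longrightarrow> neg (neg x \<oplus> y) \<oplus> neg (neg x \<oplus> neg y) = x"
begin

section \<open>Boolean laws from Huntington's axioms\<close>

lemma left_comm: "\<lbrakk>x \<in> C; y \<in> C; z \<in> C\<rbrakk> \<Longrightarrow> x \<oplus> (y \<oplus> z) = y \<oplus> (x \<oplus> z)"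
  by (metis assoc comm)

lemmas ac = assoc comm left_comm

text \<open>The axiom expands \<open>x\<close> and \<open>neg x\<close> against the same element
  \<open>neg (neg x)\<close> into four terms. Paired differently, these are the expansions of
  \<open>neg x\<close> and \<open>neg (neg x)\<close> against \<open>neg x\<close>.\<close>

lemma plus_neg_shift:
  assumes [simp]: "x \<in> C"
  shows "x \<oplus> neg x = neg x \<oplus> neg (neg x)"
proof -
  let ?n = "neg x" and ?nn = "neg (neg x)" and ?nnn = "neg (neg (neg x))"
  have "x \<oplus> ?n = neg (?n \<oplus> ?nn) \<oplus> neg (?n \<oplus> ?nnn) \<oplus> (neg (?nn \<oplus> ?nn) \<oplus> neg (?nn \<oplus> ?nnn))"
    using axiom[of x ?nn] axiom[of ?n ?nn] by simp
  also have "\<dots> = neg (?nn \<oplus> ?n) \<oplus> neg (?nn \<oplus> ?nn) \<oplus> (neg (?nnn \<oplus> ?n) \<oplus> neg (?nnn \<oplus> ?nn))"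
    by (simp add: ac)
  also have "\<dots> = ?n \<oplus> ?nn"
    using axiom[of ?n ?n] axiom[of ?nn ?n] by simp
  finally show ?thesis .
qed

text \<open>The axiom expands \<open>x\<close> and its double complement into pairs with one term in
  common; \<open>plus_neg_shift\<close> at \<open>neg x\<close> identifies the other two
  terms.\<close>

lemma neg_neg [simp]:
  assumes [simp]: "x \<in> C"
  shows "neg (neg x) = x"
proof -
  let ?n = "neg x" and ?nn = "neg (neg x)" and ?nnn = "neg (neg (neg x))"
  have "?nn = neg (?nnn \<oplus> ?n) \<oplus> neg (?nnn \<oplus> ?nn)"
    using axiom[of ?nn ?n] by simp
  also have "?nnn \<oplus> ?nn = ?n \<oplus> ?nn"
    using plus_neg_shift[of ?n] by (simp add: comm)
  also have "neg (?nnn \<oplus> ?n) \<oplus> neg (?n \<oplus> ?nn) = x"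
    using axiom[of x ?nn] by (simp add: comm)
  finally show ?thesis .
qed

lemma plus_neg_eq:
  assumes [simp]: "x \<in> C" "y \<in> C"
  shows "x \<oplus> neg x = y \<oplus> neg y"
proof -
  have "x \<oplus> neg x = neg (neg x \<oplus> y) \<oplus> neg (neg x \<oplus> neg y) \<oplus> (neg (x \<oplus> y) \<oplus> neg (x \<oplus> neg y))"
    using axiom[of x y] axiom[of "neg x" y] by simp
  also have "\<dots> = neg (neg y \<oplus> x) \<oplus> neg (neg y \<oplus> neg x) \<oplus> (neg (y \<oplus> x) \<oplus> neg (y \<oplus> neg x))"
    by (simp add: ac)
  also have "\<dots> = y \<oplus> neg y"
    using axiom[of y x] axiom[of "neg y" x] by simp
  finally show ?thesis .
qed

definition one :: 'a where "one = (let x = SOME x. x \<in> C in x \<oplus> neg x)"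

lemma plus_neg: "x \<in> C \<Longrightarrow> x \<oplus> neg x = one"
  unfolding one_def Let_def using nonempty by (intro plus_neg_eq) (simp_all add: some_in_eq)

lemma one_closed [simp]: "one \<in> C"
  using nonempty plus_neg by (metis ex_in_conv neg_closed plus_closed)

text \<open>Idempotence is reached first for \<open>one\<close>, then for its complement, which
  thereby becomes neutral. The axiom for \<open>y\<close> against \<open>neg y\<close> then
  collapses to \<open>neg (neg y \<oplus> neg y) = y\<close>, which is idempotence at
  \<open>neg y\<close>.\<close>

lemma idem [simp]:
  assumes [simp]: "x \<in> C"
  shows "x \<oplus> x = x"
proof -
  define zero where "zero = neg one"
  have [simp]: "zero \<in> C" "neg zero = one" "neg one = zero" by (simp_all add: zero_def)
  have one_zero: "one \<oplus> zero = one" using plus_neg[of one] by simp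
  have z: "zero = neg (one \<oplus> one) \<oplus> zero"
    using axiom[of zero one] one_zero by simp
  have "one = one \<oplus> (neg (one \<oplus> one) \<oplus> zero)"
    using z one_zero by simp
  also have "\<dots> = one \<oplus> zero \<oplus> neg (one \<oplus> one)"
    by (simp add: ac del: \<open>neg one = zero\<close>)
  finally have one_neg: "one = one \<oplus> neg (one \<oplus> one)"
    using one_zero by simp
  have "one = one \<oplus> (one \<oplus> neg (one \<oplus> one))"
    using plus_neg[of "one \<oplus> one"] by (simp add: assoc)
  then have "one = one \<oplus> one"
    using one_neg by simp
  with z have zz: "zero \<oplus> zero = zero" by simp
  have dbl: "y = neg (neg y \<oplus> neg y) \<oplus> zero" if "y \<in> C" for y
    using axiom[of y "neg y"] plus_neg[of "neg y"] that by simp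
  have "y \<oplus> zero = y" if "y \<in> C" for y
    using assoc[of "neg (neg y \<oplus> neg y)" zero zero] dbl[OF that, symmetric] zz that by simp
  then have "neg (neg y \<oplus> neg y) = y" if "y \<in> C" for y
    using dbl[OF that, symmetric] that by simp
  from this[of "neg x"] have "neg (neg (x \<oplus> x)) = neg (neg x)" by simp
  then show ?thesis by simp
qed

lemma plus_one: "x \<in> C \<Longrightarrow> x \<oplus> one = one"
  by (metis assoc idem neg_closed plus_neg)

lemma absorb: "\<lbrakk>x \<in> C; y \<in> C\<rbrakk> \<Longrightarrow> neg (neg x \<oplus> y) \<oplus> x = x"
  using assoc[of "neg (neg x \<oplus> y)" "neg (neg x \<oplus> y)" "neg (neg x \<oplus> neg y)"] axiom[of x y] by simp

text \<open>With the order read as \<open>a \<oplus> b = b\<close>, this turns a cover of the unit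
  into a comparison with a complement. Both the primeness of maximal ideals and the separation of
  elements rest on it.\<close>

lemma neg_le_if_plus_eq_one:
  assumes "x \<in> C" "y \<in> C" "y \<oplus> x = one"
  shows "neg x \<oplus> y = y"
proof -
  have "neg one \<oplus> neg (x \<oplus> neg y) = neg x"
    using axiom[of "neg x" y] assms by (simp add: comm)
  moreover have "neg one \<oplus> neg (x \<oplus> neg y) = neg (x \<oplus> neg y)"
    using absorb[of "neg (x \<oplus> neg y)" one] assms by (simp add: plus_one)
  ultimately have "neg x = neg (x \<oplus> neg y)"
    by (rule trans[OF sym])
  also have "\<dots> = neg (neg y \<oplus> x)"
    using assms by (simp only: comm neg_closed)
  finally show ?thesis
    using absorb[of y x] assms by simp
qed

text \<open>Read from left to right the equivalence is downward closure, because a below b means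
  \<open>a \<oplus> b = b\<close>; from right to left it is closure under joins.\<close>

definition ideal :: "'a set \<Rightarrow> bool" where
  "ideal I \<longleftrightarrow> I \<subseteq> C \<and> I \<noteq> {} \<and> one \<notin> I \<and> (\<forall>x\<in>C. \<forall>y\<in>C. x \<oplus> y \<in> I \<longleftrightarrow> x \<in> I \<and> y \<in> I)"

definition maximal_ideals :: "'a set set" where
  "maximal_ideals = {I. ideal I \<and> (\<forall>J. ideal J \<longrightarrow> I \<subseteq> J \<longrightarrow> J = I)}"

lemma ideal_generated:
  assumes "\<And>i j. \<lbrakk>i \<in> G; j \<in> G\<rbrakk> \<Longrightarrow> i \<oplus> j \<in> G" "G \<subseteq> C" "G \<noteq> {}" "one \<notin> G"
  shows "ideal {x \<in> C. \<exists>i\<in>G. x \<oplus> i = i}"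
  unfolding ideal_def
proof (intro conjI ballI iffI)
  let ?J = "{x \<in> C. \<exists>i\<in>G. x \<oplus> i = i}"
  show "?J \<subseteq> C" by blast
  obtain i where "i \<in> G" "i \<in> C" using assms(2,3) by blast
  then have "i \<in> ?J" by (auto intro!: bexI[of _ i])
  then show "?J \<noteq> {}" by blast
  show "one \<notin> ?J"
  proof
    assume "one \<in> ?J"
    then obtain i where "i \<in> G" "one \<oplus> i = i" by blast
    moreover from this have "one \<oplus> i = one" using assms(2) plus_one[of i] comm[of i one] by auto
    ultimately show False using assms(4) by simp
  qed
next
  fix x y assume C: "x \<in> C" "y \<in> C" and "x \<oplus> y \<in> {x \<in> C. \<exists>i\<in>G. x \<oplus> i = i}"
  then obtain i where i: "i \<in> G" "i \<in> C" "x \<oplus> y \<oplus> i = i" using assms by blast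
  have "x \<oplus> (x \<oplus> y \<oplus> i) = x \<oplus> x \<oplus> y \<oplus> i" "y \<oplus> (x \<oplus> y \<oplus> i) = x \<oplus> (y \<oplus> y) \<oplus> i"
    using C i(2) by (simp_all add: ac del: idem)
  then have "x \<oplus> i = i" "y \<oplus> i = i" using C i(3) by simp_all
  with C i show "x \<in> {x \<in> C. \<exists>i\<in>G. x \<oplus> i = i}" "y \<in> {x \<in> C. \<exists>i\<in>G. x \<oplus> i = i}" by blast+
next
  fix x y assume C: "x \<in> C" "y \<in> C"
    and "x \<in> {x \<in> C. \<exists>i\<in>G. x \<oplus> i = i} \<and> y \<in> {x \<in> C. \<exists>i\<in>G. x \<oplus> i = i}"
  then obtain i j where i: "i \<in> G" "i \<in> C" "x \<oplus> i = i" and j: "j \<in> G" "j \<in> C" "y \<oplus> j = j"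
    using assms by blast
  have "x \<oplus> y \<oplus> (i \<oplus> j) = (x \<oplus> i) \<oplus> (y \<oplus> j)" using C i(2) j(2) by (simp add: ac)
  then have "x \<oplus> y \<oplus> (i \<oplus> j) = i \<oplus> j" using i j by simp
  moreover have "i \<oplus> j \<in> G" using assms(1) i(1) j(1) .
  ultimately show "x \<oplus> y \<in> {x \<in> C. \<exists>i\<in>G. x \<oplus> i = i}" using C by auto
qed

text \<open>If \<open>x\<close> is outside \<open>I\<close>, the ideal generated by \<open>I\<close>
  and \<open>x\<close> is improper by maximality, so \<open>i \<oplus> x = one\<close> for some
  \<open>i\<close> in \<open>I\<close>; then \<open>neg x\<close> lies below
  \<open>i\<close>.\<close>

lemma maximal_ideal_neg:
  assumes I: "I \<in> maximal_ideals" and x: "x \<in> C"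
  shows "neg x \<in> I \<longleftrightarrow> x \<notin> I"
proof
  have id: "ideal I" and max: "\<And>J. \<lbrakk>ideal J; I \<subseteq> J\<rbrakk> \<Longrightarrow> J = I"
    using I by (auto simp: maximal_ideals_def)
  have IC: "I \<subseteq> C" and ne: "I \<noteq> {}" and one: "one \<notin> I"
    and plusI: "\<And>x y. \<lbrakk>x \<in> C; y \<in> C\<rbrakk> \<Longrightarrow> x \<oplus> y \<in> I \<longleftrightarrow> x \<in> I \<and> y \<in> I"
    using id by (auto simp: ideal_def)
  show "x \<notin> I" if "neg x \<in> I"
    using that plusI[of x "neg x"] one x plus_neg by auto
  show "neg x \<in> I" if "x \<notin> I"
  proof -
    define G where "G = (\<lambda>i. i \<oplus> x) ` I"
    have "one \<in> G"
    proof (rule ccontr)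
      assume "one \<notin> G"
      moreover have "i \<oplus> j \<in> G" if ij: "i \<in> G" "j \<in> G" for i j
      proof -
        obtain i' j' where "i = i' \<oplus> x" "j = j' \<oplus> x" "i' \<in> I" "j' \<in> I" using ij G_def by auto
        moreover from this have "i' \<oplus> x \<oplus> (j' \<oplus> x) = (i' \<oplus> j') \<oplus> (x \<oplus> x)"
          using x IC by (simp add: subset_iff ac del: idem)
        moreover have "i' \<oplus> j' \<in> I" using calculation plusI IC by blast
        ultimately show ?thesis using x G_def by auto
      qed
      moreover have "G \<subseteq> C" "G \<noteq> {}" using IC x ne G_def by auto
      ultimately have "ideal {y \<in> C. \<exists>i\<in>G. y \<oplus> i = i}" by (intro ideal_generated)
      moreover have "I \<subseteq> {y \<in> C. \<exists>i\<in>G. y \<oplus> i = i}"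
      proof
        fix y assume "y \<in> I"
        moreover have "y \<oplus> (y \<oplus> x) = y \<oplus> x"
          using \<open>y \<in> I\<close> IC x by (simp add: subset_iff flip: assoc)
        ultimately show "y \<in> {y \<in> C. \<exists>i\<in>G. y \<oplus> i = i}" using IC by (auto simp: G_def)
      qed
      ultimately have "{y \<in> C. \<exists>i\<in>G. y \<oplus> i = i} = I" by (rule max)
      moreover have "x \<in> {y \<in> C. \<exists>i\<in>G. y \<oplus> i = i}"
      proof -
        obtain i where "i \<in> I" "i \<in> C" using ne IC by blast
        moreover have "x \<oplus> (i \<oplus> x) = i \<oplus> (x \<oplus> x)" using \<open>i \<in> C\<close> x by (simp add: ac del: idem)
        ultimately show ?thesis using x by (auto simp: G_def)
      qed
      ultimately show False using that by blast
    qed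
    then obtain i where i: "i \<in> I" "i \<oplus> x = one" using G_def by auto
    then show ?thesis
      using neg_le_if_plus_eq_one[OF x, of i] plusI[of "neg x" i] IC x by auto
  qed
qed

lemma ideal_in_maximal:
  assumes "ideal I"
  obtains M where "M \<in> maximal_ideals" "I \<subseteq> M"
proof -
  have "\<exists>M\<in>{J. ideal J \<and> I \<subseteq> J}. \<forall>X\<in>{J. ideal J \<and> I \<subseteq> J}. M \<subseteq> X \<longrightarrow> X = M"
  proof (rule subset_Zorn_nonempty)
    show "{J. ideal J \<and> I \<subseteq> J} \<noteq> {}" using assms by blast
    fix Ch assume ne: "Ch \<noteq> {}" and ch: "subset.chain {J. ideal J \<and> I \<subseteq> J} Ch"
    have mem: "ideal J" "I \<subseteq> J" if "J \<in> Ch" for J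
      using ch that by (auto simp: subset.chain_def)
    have tot: "J \<subseteq> L \<or> L \<subseteq> J" if "J \<in> Ch" "L \<in> Ch" for J L
      using ch that unfolding subset_chain_def by blast
    have "ideal (\<Union>Ch)"
      unfolding ideal_def
    proof (intro conjI ballI iffI)
      show "\<Union>Ch \<subseteq> C" "\<Union>Ch \<noteq> {}" "one \<notin> \<Union>Ch"
        using mem ne by (fastforce simp: ideal_def)+
    next
      fix x y assume "x \<in> C" "y \<in> C" "x \<oplus> y \<in> \<Union>Ch"
      then show "x \<in> \<Union>Ch" "y \<in> \<Union>Ch" using mem(1) unfolding ideal_def by blast+
    next
      fix x y assume "x \<in> C" "y \<in> C" "x \<in> \<Union>Ch \<and> y \<in> \<Union>Ch"
      then obtain J where "J \<in> Ch" "x \<in> J" "y \<in> J" using tot by blast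
      then show "x \<oplus> y \<in> \<Union>Ch" using mem(1) \<open>x \<in> C\<close> \<open>y \<in> C\<close> unfolding ideal_def by blast
    qed
    then show "\<Union>Ch \<in> {J. ideal J \<and> I \<subseteq> J}" using mem(2) ne by blast
  qed
  then obtain M where M: "ideal M" "I \<subseteq> M" "\<And>X. \<lbrakk>ideal X; I \<subseteq> X; M \<subseteq> X\<rbrakk> \<Longrightarrow> X = M" by auto
  then have "M \<in> maximal_ideals" unfolding maximal_ideals_def by blast
  with M(2) show ?thesis by (rule that[rotated])
qed

text \<open>A maximal ideal stands for the ultrafilter that is its complement, hence the negated
  membership.\<close>

definition stone :: "'a \<Rightarrow> 'a set set" where
  "stone x = {I \<in> maximal_ideals. x \<notin> I}"

lemma stone_subset: "stone x \<subseteq> maximal_ideals"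
  by (auto simp: stone_def)

lemma stone_plus: "\<lbrakk>x \<in> C; y \<in> C\<rbrakk> \<Longrightarrow> stone (x \<oplus> y) = stone x \<union> stone y"
  by (auto simp: stone_def maximal_ideals_def ideal_def)

lemma stone_neg: "x \<in> C \<Longrightarrow> stone (neg x) = maximal_ideals - stone x"
  using maximal_ideal_neg by (auto simp: stone_def)

text \<open>If \<open>x\<close> is not below \<open>y\<close>, then \<open>y \<oplus> neg x\<close>
  is not the unit. A maximal ideal above it contains \<open>y\<close> and \<open>neg x\<close>, so
  it is a point of \<open>stone x\<close> outside \<open>stone y\<close>.\<close>

lemma stone_subset_imp_le:
  assumes x: "x \<in> C" and y: "y \<in> C" and le: "stone x \<subseteq> stone y"
  shows "x \<oplus> y = y"
proof (rule ccontr)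
  assume neq: "x \<oplus> y \<noteq> y"
  let ?z = "y \<oplus> neg x"
  have "?z \<noteq> one" using neq neg_le_if_plus_eq_one[of "neg x" y] x y by auto
  then have "ideal {w \<in> C. \<exists>i\<in>{?z}. w \<oplus> i = i}"
    using x y by (intro ideal_generated) auto
  then obtain M where M: "M \<in> maximal_ideals" "{w \<in> C. \<exists>i\<in>{?z}. w \<oplus> i = i} \<subseteq> M"
    by (rule ideal_in_maximal)
  have "y \<oplus> ?z = y \<oplus> y \<oplus> neg x" "neg x \<oplus> ?z = y \<oplus> (neg x \<oplus> neg x)"
    using x y by (simp_all add: ac del: idem)
  then have "y \<oplus> ?z = ?z" "neg x \<oplus> ?z = ?z" using x y by simp_all
  then have "y \<in> M" "neg x \<in> M" using M(2) x y by auto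
  then show False using M(1) maximal_ideal_neg[OF M(1) x] le by (auto simp: stone_def)
qed

lemma stone_inj: "inj_on stone C"
  by (rule inj_onI) (metis comm order_refl stone_subset_imp_le)

end

section \<open>Cylindric fields of sets\<close>

text \<open>Only the Boolean part is concrete: points of \<open>U\<close> are ultrafilters rather
  than assignments, and \<open>c i\<close> remains an abstract operator, constrained on
  \<open>K\<close> alone.\<close>

locale cylindric_field =
  fixes m :: nat and U :: "'s set" and K :: "'s set set"
    and c :: "nat \<Rightarrow> 's set \<Rightarrow> 's set" and d :: "nat \<Rightarrow> nat \<Rightarrow> 's set"
  assumes sub_U: "x \<in> K \<Longrightarrow> x \<subseteq> U"
    and un_closed [simp]: "\<lbrakk>x \<in> K; y \<in> K\<rbrakk> \<Longrightarrow> x \<union> y \<in> K"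
    and compl_closed [simp]: "x \<in> K \<Longrightarrow> U - x \<in> K"
    and c_closed [simp]: "\<lbrakk>i < m; x \<in> K\<rbrakk> \<Longrightarrow> c i x \<in> K"
    and d_closed [simp]: "\<lbrakk>i < m; j < m\<rbrakk> \<Longrightarrow> d i j \<in> K"
    and c_empty: "i < m \<Longrightarrow> c i {} = {}"
    and c_incr: "\<lbrakk>i < m; x \<in> K\<rbrakk> \<Longrightarrow> x \<subseteq> c i x"
    and c_int_c: "\<lbrakk>i < m; x \<in> K; y \<in> K\<rbrakk> \<Longrightarrow> c i (x \<inter> c i y) = c i x \<inter> c i y"
    and c_comm: "\<lbrakk>i < m; j < m; x \<in> K\<rbrakk> \<Longrightarrow> c i (c j x) = c j (c i x)"
    and d_refl: "i < m \<Longrightarrow> d i i = U"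
    and d_comp: "\<lbrakk>i < m; j < m; k < m; k \<noteq> i; k \<noteq> j\<rbrakk> \<Longrightarrow> d i j = c k (d i k \<inter> d k j)"
    and d_split: "\<lbrakk>i < m; j < m; x \<in> K; i \<noteq> j\<rbrakk> \<Longrightarrow> c i (d i j \<inter> x) \<inter> c i (d i j \<inter> (U - x)) = {}"
begin

section \<open>Laws of cylindrification\<close>

lemma int_closed [simp]: "\<lbrakk>x \<in> K; y \<in> K\<rbrakk> \<Longrightarrow> x \<inter> y \<in> K"
proof -
  assume "x \<in> K" "y \<in> K"
  moreover from this have "x \<inter> y = U - ((U - x) \<union> (U - y))" using sub_U by blast
  ultimately show ?thesis by simp
qed

lemma U_closed: "i < m \<Longrightarrow> U \<in> K"
  using d_closed[of i i] d_refl by simp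

lemma c_mono: "\<lbrakk>i < m; x \<in> K; y \<in> K; x \<subseteq> y\<rbrakk> \<Longrightarrow> c i x \<subseteq> c i y"
  using c_int_c[of i x y] c_incr[of i y] by (metis inf.absorb_iff1 inf.order_iff subset_trans)

lemma c_U: "i < m \<Longrightarrow> c i U = U"
  using c_incr U_closed sub_U by (metis c_closed subset_antisym)

lemma c_idem: "\<lbrakk>i < m; x \<in> K\<rbrakk> \<Longrightarrow> c i (c i x) = c i x"
  using c_int_c[of i U x] c_U[of i] U_closed[of i] sub_U[of "c i x"] by (simp add: Int_absorb1)

lemma c_int_closed: "\<lbrakk>i < m; x \<in> K; y \<in> K; c i y = y\<rbrakk> \<Longrightarrow> c i (x \<inter> y) = c i x \<inter> y"
  using c_int_c[of i x y] by simp

lemma c_compl: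
  assumes "i < m" "x \<in> K" "c i x = x"
  shows "c i (U - x) = U - x"
proof
  have "c i (U - x) \<inter> x = c i ((U - x) \<inter> x)" using assms by (simp add: c_int_closed)
  then have "c i (U - x) \<inter> x = {}" using c_empty[OF assms(1)] by (simp add: Diff_disjoint Int_commute)
  then show "c i (U - x) \<subseteq> U - x" using sub_U[of "c i (U - x)"] assms by auto
  show "U - x \<subseteq> c i (U - x)" using assms by (intro c_incr) auto
qed

text \<open>The union of two fixed sets of \<open>c i\<close> is fixed, since its complement is an
  intersection of fixed sets; monotonicity does the rest.\<close>

lemma c_un:
  assumes "i < m" "x \<in> K" "y \<in> K"
  shows "c i (x \<union> y) = c i x \<union> c i y"
proof
  let ?z = "c i x \<union> c i y"
  have z: "?z = U - ((U - c i x) \<inter> (U - c i y))"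
    using sub_U assms by (metis Diff_Int Diff_Diff_Int c_closed inf.absorb_iff2)
  have "c i ((U - c i x) \<inter> (U - c i y)) = (U - c i x) \<inter> (U - c i y)"
    using assms by (simp add: c_int_closed c_compl c_idem)
  then have "c i ?z = ?z" using assms by (subst (1 2) z) (simp add: c_compl)
  moreover have "x \<union> y \<subseteq> ?z" using assms c_incr by blast
  ultimately show "c i (x \<union> y) \<subseteq> ?z"
    using c_mono[of i "x \<union> y" ?z] assms by auto
  show "?z \<subseteq> c i (x \<union> y)" using assms by (simp add: c_mono)
qed

text \<open>Finite additivity of \<open>c i\<close> read at a single point. It is what allows a
  colour to be picked at one Stone point from a finite cover by colours.\<close>

lemma c_Union_subset:
  assumes "i < m" "finite F" "F \<subseteq> K" "x \<in> K" "x \<subseteq> \<Union>F" "t \<in> c i x"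
  shows "\<exists>y\<in>F. t \<in> c i (x \<inter> y)"
  using assms(2,3,4,5,6)
proof (induction F arbitrary: x)
  case empty then show ?case using c_empty[OF assms(1)] by auto
next
  case (insert y F)
  have "x = (x \<inter> y) \<union> (x \<inter> (U - y))" using sub_U[OF \<open>x \<in> K\<close>] by auto
  then have "c i x = c i (x \<inter> y) \<union> c i (x \<inter> (U - y))"
    using insert.prems assms(1) by (metis c_un compl_closed insert_subset int_closed)
  then consider "t \<in> c i (x \<inter> y)" | "t \<in> c i (x \<inter> (U - y))" using insert.prems by auto
  then show ?case
  proof cases
    case 2
    have "\<exists>z\<in>F. t \<in> c i (x \<inter> (U - y) \<inter> z)"
      using insert.prems 2 by (intro insert.IH) auto
    then obtain z where z: "z \<in> F" "t \<in> c i (x \<inter> (U - y) \<inter> z)" by blast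
    moreover from z have "z \<in> K" using insert.prems by auto
    ultimately have "t \<in> c i (x \<inter> z)"
      using c_mono[of i "x \<inter> (U - y) \<inter> z" "x \<inter> z"] insert.prems assms(1)
      by (simp add: subset_iff)
    then show ?thesis using z by blast
  qed blast
qed

section \<open>Diagonals and substitutions\<close>

lemma c_d: "\<lbrakk>i < m; j < m; k < m; k \<noteq> i; k \<noteq> j\<rbrakk> \<Longrightarrow> c k (d i j) = d i j"
  using d_comp c_idem by (metis d_closed int_closed)

lemma c_d_eq_U: "\<lbrakk>i < m; j < m; i \<noteq> j\<rbrakk> \<Longrightarrow> c i (d j i \<inter> d i j) = U"
  using d_comp[of j j i] d_refl by simp

text \<open>The composition axiom applied to \<open>d j j\<close> gives
  \<open>c i (d j i \<inter> d i j) = U\<close>. By \<open>d_split\<close> with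
  \<open>x = d j i\<close>, nothing of \<open>d i j\<close> can then remain outside
  \<open>d j i\<close>.\<close>

lemma d_subset_swap:
  assumes "i < m" "j < m" "i \<noteq> j"
  shows "d i j \<subseteq> d j i"
proof -
  have "c i (d i j \<inter> d j i) \<inter> c i (d i j \<inter> (U - d j i)) = {}"
    using assms by (intro d_split) auto
  then have "c i (d i j \<inter> (U - d j i)) = {}"
    using c_d_eq_U[OF assms] sub_U[of "c i (d i j \<inter> (U - d j i))"] assms U_closed[OF assms(1)]
    by (simp add: Int_commute Int_absorb1)
  then have "d i j \<inter> (U - d j i) = {}"
    using c_incr[of i "d i j \<inter> (U - d j i)"] assms by auto
  then show ?thesis using sub_U[of "d i j"] assms by auto
qed

lemma d_sym: "\<lbrakk>i < m; j < m\<rbrakk> \<Longrightarrow> d i j = d j i"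
  using d_subset_swap by (cases "i = j") auto

lemma c_d_left: "\<lbrakk>i < m; j < m; i \<noteq> j\<rbrakk> \<Longrightarrow> c i (d i j) = U"
  using c_d_eq_U d_sym by (metis inf.idem)

lemma c_d_right: "\<lbrakk>i < m; j < m; i \<noteq> j\<rbrakk> \<Longrightarrow> c j (d i j) = U"
  using c_d_left d_sym by metis

text \<open>The case \<open>i = j\<close> is set to the identity because
  \<open>c i (d i i \<inter> x)\<close> would be \<open>c i x\<close>; the transports built from
  \<open>s\<close> thus need no separate case for an index already in place.\<close>

definition s :: "nat \<Rightarrow> nat \<Rightarrow> 's set \<Rightarrow> 's set" where
  "s i j x = (if i = j then x else c i (d i j \<inter> x))"

lemma s_closed [simp]: "\<lbrakk>i < m; j < m; x \<in> K\<rbrakk> \<Longrightarrow> s i j x \<in> K"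
  by (simp add: s_def)

lemma s_refl [simp]: "s i i x = x"
  by (simp add: s_def)

lemma s_un: "\<lbrakk>i < m; j < m; x \<in> K; y \<in> K\<rbrakk> \<Longrightarrow> s i j (x \<union> y) = s i j x \<union> s i j y"
  by (simp add: s_def Int_Un_distrib c_un)

lemma s_empty: "i < m \<Longrightarrow> s i j {} = {}"
  by (simp add: s_def c_empty)

text \<open>The images of \<open>x\<close> and of its complement are disjoint by
  \<open>d_split\<close> and cover \<open>U\<close> because \<open>c i (d i j) = U\<close>. Hence
  substitution is a Boolean endomorphism.\<close>

lemma s_compl:
  assumes "i < m" "j < m" "x \<in> K"
  shows "s i j (U - x) = U - s i j x"
proof (cases "i = j")
  case False
  have "c i (d i j \<inter> x) \<union> c i (d i j \<inter> (U - x)) = c i ((d i j \<inter> x) \<union> (d i j \<inter> (U - x)))"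
    using assms by (simp add: c_un)
  also have "(d i j \<inter> x) \<union> (d i j \<inter> (U - x)) = d i j"
    using assms sub_U[of "d i j"] by auto
  finally have "c i (d i j \<inter> x) \<union> c i (d i j \<inter> (U - x)) = U"
    using c_d_left assms False by simp
  then show ?thesis using d_split[OF assms False] False by (auto simp: s_def)
qed simp

lemma s_int:
  assumes "i < m" "j < m" "x \<in> K" "y \<in> K"
  shows "s i j (x \<inter> y) = s i j x \<inter> s i j y"
proof -
  have "x \<inter> y = U - ((U - x) \<union> (U - y))" using sub_U assms by blast
  then have "s i j (x \<inter> y) = U - ((U - s i j x) \<union> (U - s i j y))"
    using assms by (simp add: s_compl s_un)
  then show ?thesis using sub_U[of "s i j x"] sub_U[of "s i j y"] assms by auto
qed

lemma s_mono: "\<lbrakk>i < m; j < m; x \<in> K; y \<in> K; x \<subseteq> y\<rbrakk> \<Longrightarrow> s i j x \<subseteq> s i j y"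
  by (metis inf.absorb_iff1 s_int)

text \<open>One inclusion holds because \<open>c i\<close> is increasing; the same inclusion for the
  complement yields the other.\<close>

lemma d_int_s:
  assumes "i < m" "j < m" "x \<in> K"
  shows "d i j \<inter> s i j x = d i j \<inter> x"
proof (cases "i = j")
  case False
  have "d i j \<inter> y \<subseteq> s i j y" if "y \<in> K" for y
    using c_incr[of i "d i j \<inter> y"] assms that False by (simp add: s_def)
  from this[of x] this[of "U - x"] show ?thesis
    using assms s_compl[OF assms] sub_U[of "d i j"] by auto
qed simp

lemma c_s: "\<lbrakk>i < m; j < m; x \<in> K; i \<noteq> j\<rbrakk> \<Longrightarrow> c i (s i j x) = s i j x"
  by (simp add: s_def c_idem)

lemma c_s_other:
  "\<lbrakk>i < m; j < m; k < m; x \<in> K; k \<noteq> i; k \<noteq> j\<rbrakk> \<Longrightarrow> c k (s i j x) = s i j (c k x)"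
  by (cases "i = j") (simp_all add: s_def c_comm c_int_closed c_d Int_commute[of "d i j"])

lemma s_closed_elem:
  "\<lbrakk>i < m; j < m; x \<in> K; c i x = x\<rbrakk> \<Longrightarrow> s i j x = x"
  using sub_U[of x] by (cases "i = j") (auto simp: s_def c_int_closed c_d_left)

lemma s_s_back:
  assumes "i < m" "j < m" "x \<in> K" "c j x = x"
  shows "s j i (s i j x) = x"
proof (cases "i = j")
  case False
  have "s j i (s i j x) = c j (d i j \<inter> s i j x)"
    using False assms by (simp add: s_def d_sym[of j i])
  also have "\<dots> = c j (d i j \<inter> x)" using d_int_s assms by simp
  also have "\<dots> = x" using assms False sub_U[of x] by (auto simp: c_int_closed c_d_right)
  finally show ?thesis .
qed simp

text \<open>As \<open>x\<close> does not depend on k, the two cylindrifications can be exchanged so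
  that \<open>c k\<close> meets only \<open>d i k \<inter> d k j\<close>, which it collapses to
  \<open>d i j\<close>.\<close>

lemma s_trans:
  assumes "i < m" "j < m" "k < m" "x \<in> K" "c k x = x" "k \<noteq> i" "i \<noteq> j"
  shows "s k j (s i k x) = s i j x"
proof (cases "k = j")
  case False
  have "s k j (s i k x) = c k (d k j \<inter> c i (d i k \<inter> x))"
    using assms False by (simp add: s_def)
  also have "d k j \<inter> c i (d i k \<inter> x) = c i (d i k \<inter> x \<inter> d k j)"
    using c_int_closed[of i "d i k \<inter> x" "d k j"] assms by (simp add: c_d Int_commute)
  also have "d i k \<inter> x \<inter> d k j = d i k \<inter> d k j \<inter> x" by (simp add: Int_ac)
  also have "c k (c i \<dots>) = c i (c k (d i k \<inter> d k j \<inter> x))"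
    using assms by (simp add: c_comm)
  also have "c k (d i k \<inter> d k j \<inter> x) = d i j \<inter> x"
    using assms False d_comp[of i j k] by (simp add: c_int_closed)
  finally show ?thesis using assms by (simp add: s_def)
qed (use assms in simp)

lemma s_comm:
  assumes "i < m" "j < m" "k < m" "l < m" "x \<in> K" "i \<noteq> k" "i \<noteq> l" "k \<noteq> j"
  shows "s i j (s k l x) = s k l (s i j x)"
proof (cases "i = j \<or> k = l")
  case False
  have "s i j (s k l x) = c i (d i j \<inter> c k (d k l \<inter> x))"
    using False by (simp add: s_def)
  also have "d i j \<inter> c k (d k l \<inter> x) = c k (d k l \<inter> x \<inter> d i j)"
    using c_int_closed[of k "d k l \<inter> x" "d i j"] assms by (simp add: c_d Int_commute)
  also have "d k l \<inter> x \<inter> d i j = d i j \<inter> x \<inter> d k l" by (simp add: Int_ac)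
  also have "c i (c k \<dots>) = c k (c i (d i j \<inter> x \<inter> d k l))"
    using assms by (simp add: c_comm)
  also have "c i (d i j \<inter> x \<inter> d k l) = c i (d i j \<inter> x) \<inter> d k l"
    using assms by (simp add: c_int_closed c_d)
  finally show ?thesis using False by (simp add: s_def Int_commute)
qed auto

text \<open>Change of a bound variable: i is replaced by j, which is fresh for
  \<open>x\<close>.\<close>

lemma c_rename:
  assumes "i < m" "j < m" "x \<in> K" "c j x = x"
  shows "c j (s i j x) = c i x"
proof (cases "i = j")
  case False
  have "c j (s i j x) = c i (c j (d i j \<inter> x))"
    using False assms by (simp add: s_def c_comm)
  also have "c j (d i j \<inter> x) = x"
    using assms False sub_U[of x] by (auto simp: c_int_closed c_d_right)
  finally show ?thesis .
qed (use assms in simp)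

text \<open>The elements of \<open>Ra\<close> are those depending on coordinates 0 and 1 only; \<open>T i j\<close> transports
  them to coordinates \<open>i < j\<close>, for which no auxiliary coordinate is needed.\<close>

definition binary :: "'s set set" where
  "binary = {x \<in> K. \<forall>k. 2 \<le> k \<longrightarrow> k < m \<longrightarrow> c k x = x}"

definition T :: "nat \<Rightarrow> nat \<Rightarrow> 's set \<Rightarrow> 's set" where
  "T i j x = s 0 i (s 1 j x)"

section \<open>Labels transported to increasing pairs of coordinates\<close>

lemma binaryD: "x \<in> binary \<Longrightarrow> x \<in> K" "\<lbrakk>x \<in> binary; 2 \<le> k; k < m\<rbrakk> \<Longrightarrow> c k x = x"
  by (auto simp: binary_def)

lemma T_closed [simp]: "\<lbrakk>i < j; j < m; x \<in> binary\<rbrakk> \<Longrightarrow> T i j x \<in> K"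
  by (simp add: T_def binaryD)

lemma T_mono: "\<lbrakk>i < j; j < m; x \<in> binary; y \<in> binary; x \<subseteq> y\<rbrakk> \<Longrightarrow> T i j x \<subseteq> T i j y"
  by (simp add: T_def s_mono binaryD)

lemma T_int: "\<lbrakk>i < j; j < m; x \<in> K; y \<in> K\<rbrakk> \<Longrightarrow> T i j (x \<inter> y) = T i j x \<inter> T i j y"
  by (simp add: T_def s_int)

lemma T_un: "\<lbrakk>i < j; j < m; x \<in> K; y \<in> K\<rbrakk> \<Longrightarrow> T i j (x \<union> y) = T i j x \<union> T i j y"
  by (simp add: T_def s_un)

lemma T_empty: "\<lbrakk>i < j; j < m\<rbrakk> \<Longrightarrow> T i j {} = {}"
  by (simp add: T_def s_empty)

lemma T_U: "\<lbrakk>i < j; j < m\<rbrakk> \<Longrightarrow> T i j U = U"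
  using U_closed[of 0] U_closed[of 1] c_U by (simp add: T_def s_closed_elem)

lemma T_0_1: "T 0 (Suc 0) x = x"
  by (simp add: T_def)

lemma c_T:
  assumes "i < j" "j < m" "x \<in> binary" "k < m" "k \<noteq> i" "k \<noteq> j"
  shows "c k (T i j x) = T i j x"
proof -
  have x: "x \<in> K" and cx: "\<And>k. \<lbrakk>2 \<le> k; k < m\<rbrakk> \<Longrightarrow> c k x = x" using assms binaryD by auto
  have y: "s 1 j x \<in> K" using assms x by simp
  \<comment> \<open>After \<open>s 1 j\<close> the set depends on 0 and j only. The outer
    \<open>s 0 i\<close> then trades 0 for i, which is how coordinate 1 can come back when i is
    1.\<close>
  have cy: "c l (s 1 j x) = s 1 j x" if "l < m" "l \<noteq> 0" "l \<noteq> j" for l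
  proof (cases "l = 1")
    case True then show ?thesis using that assms x by (simp add: c_s)
  next
    case False then show ?thesis using that assms x cx by (subst c_s_other) auto
  qed
  show ?thesis
  proof (cases "k = 0")
    case True then show ?thesis using assms y by (simp add: T_def c_s)
  next
    case False then show ?thesis using assms y cy unfolding T_def by (subst c_s_other) auto
  qed
qed

lemma s_T:
  assumes "i < k" "i < l" "l < m" "k < m" "2 \<le> k" "x \<in> binary"
  shows "s k l (T i k x) = T i l x"
proof -
  have x: "x \<in> K" and cx: "c k x = x" using assms binaryD by auto
  have "s k l (s 0 i (s 1 k x)) = s 0 i (s k l (s 1 k x))"
    using assms x by (intro s_comm) auto
  also have "s k l (s 1 k x) = s 1 l x"
  proof (cases "l = 1")
    case True then show ?thesis using s_s_back[of 1 k x] x cx assms by simp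
  next
    case False then show ?thesis using x cx assms by (intro s_trans) auto
  qed
  finally show ?thesis by (simp add: T_def)
qed

lemma T_d:
  assumes "i < j" "j < m"
  shows "T i j (d 0 1) = d i j"
proof -
  have st: "s k l (d i' k) = d i' l" if "i' < m" "k < m" "l < m" "k \<noteq> i'" "k \<noteq> l" for i' k l
    using d_comp[of i' l k] that by (simp add: s_def Int_commute)
  have "s 1 j (d 0 1) = d 0 j"
    using st[of 0 1 j] assms by (cases "j = 1") auto
  moreover have "s 0 i (d 0 j) = d i j"
    using st[of j 0 i] assms d_sym[of 0 j] d_sym[of i j] by (cases "i = 0") auto
  ultimately show ?thesis by (simp add: T_def)
qed

text \<open>Equal points have equal edges to a third point. This later shows that a waiting
  neighbour differs from the point just placed.\<close>

lemma d_int_T: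
  assumes "i < k" "i < l" "k < m" "l < m" "2 \<le> k" "x \<in> binary"
  shows "d k l \<inter> T i k x = d k l \<inter> T i l x"
  using d_int_s[of k l "T i k x"] s_T[of i k l x] assms by simp

text \<open>The coordinate 2 bound in the relative product may clash with \<open>i\<close> or \<open>j\<close>, hence the
  renaming to \<open>k\<close>.\<close>

lemma T_comp:
  assumes "i < j" "j < k" "k < m" "3 \<le> k" "x \<in> binary" "y \<in> binary"
  shows "T i j (c 2 (T 0 2 x \<inter> T 1 2 y)) = c k (T i k x \<inter> T j k y)"
proof -
  have K: "x \<in> K" "y \<in> K" using assms binaryD by auto
  have TK: "T 0 k x \<in> K" "T 1 k y \<in> K" using assms by simp_all
  have "c 2 (T 0 2 x \<inter> T 1 2 y) = c k (s 2 k (T 0 2 x \<inter> T 1 2 y))"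
    using assms by (subst c_rename) (auto simp: c_int_closed c_T)
  also have "s 2 k (T 0 2 x \<inter> T 1 2 y) = T 0 k x \<inter> T 1 k y"
    using assms by (simp add: s_int s_T)
  finally have "T i j (c 2 (T 0 2 x \<inter> T 1 2 y)) = s 0 i (s 1 j (c k (T 0 k x \<inter> T 1 k y)))"
    by (simp add: T_def[of i j])
  also have "\<dots> = c k (s 0 i (s 1 j (T 0 k x) \<inter> s 1 j (T 1 k y)))"
    using assms TK by (simp add: s_int c_s_other[symmetric])
  also have "s 1 j (T 0 k x) = T 0 k x"
    using assms TK by (intro s_closed_elem) (auto simp: c_T)
  \<comment> \<open>Coordinate 1 is only an intermediate stop here: the move from 0 to 1 followed by
    the move from 1 to j is the move from 0 to j.\<close>
  also have "s 1 j (T 1 k y) = T j k y"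
  proof -
    have "s 1 j (s 0 1 (s 1 k y)) = s 0 j (s 1 k y)"
      using assms K by (intro s_trans) (auto simp: c_s)
    then show ?thesis by (simp add: T_def)
  qed
  also have "s 0 i (T 0 k x \<inter> T j k y) = T i k x \<inter> T j k y"
    using assms TK s_closed_elem[of 0 i "T j k y"] by (simp add: s_int c_T) (simp add: T_def)
  finally show ?thesis .
qed

end

section \<open>The Ramsey argument\<close>

text \<open>The subtracted 1 is the neighbour spent as the new point. If every class had at most p^e
  - 1 elements, there would be at most (p - 1)(p^e - 1) in all, which is too few.\<close>

lemma pigeonhole_power:
  fixes f :: "'x \<Rightarrow> 'y" and p e :: nat
  assumes "finite X" "f ` X \<subseteq> Q" "finite Q" "card Q < p" "p ^ Suc e - 1 \<le> card X" "2 \<le> p"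
  obtains q where "q \<in> Q" "p ^ e \<le> card {x \<in> X. f x = q}"
proof (rule ccontr)
  assume neg: "\<not> thesis"
  note found = that
  have small: "card {x \<in> X. f x = q} \<le> p ^ e - 1" if q: "q \<in> Q" for q
    using found[OF q] neg by linarith
  have "card X \<le> card (\<Union>q\<in>Q. {x \<in> X. f x = q})"
    using assms by (intro card_mono) auto
  also have "\<dots> \<le> (\<Sum>q\<in>Q. card {x \<in> X. f x = q})"
    using assms by (intro card_UN_le)
  also have "\<dots> \<le> card Q * (p ^ e - 1)"
    using small sum_bounded_above[of Q "\<lambda>q. card {x \<in> X. f x = q}" "p ^ e - 1"] by simp
  also have "\<dots> \<le> (p - 1) * (p ^ e - 1)"
    using assms by (intro mult_right_mono) auto
  finally have "p ^ Suc e - 1 \<le> (p - 1) * (p ^ e - 1)" using assms by simp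
  \<comment> \<open>Substituting p = 2 + r and p^e = 1 + w removes the truncated subtractions; the
    inequality becomes 1 + r + (2 + r) w \<le> (1 + r) w.\<close>
  moreover obtain r where "p = 2 + r" using assms(6) le_Suc_ex by blast
  moreover obtain w where "p ^ e = 1 + w"
    using assms(6) le_Suc_ex[of 1 "p ^ e"] by (auto simp: Suc_le_eq)
  ultimately show False by simp
qed

section \<open>Selecting points one coordinate at a time\<close>

context cylindric_field
begin

text \<open>The conditions on a waiting neighbour at coordinate \<open>p\<close>. Its edge to point
  0 is constrained twice: by the fine label \<open>b\<close>, which tells neighbours apart, and by
  the coarse colour \<open>col 0\<close>.\<close>

definition fan :: "nat \<Rightarrow> (nat \<Rightarrow> 's set) \<Rightarrow> nat \<Rightarrow> 's set \<Rightarrow> 's set" where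
  "fan p col k b = T 0 p b \<inter> (\<Inter>i\<in>{..k}. T i p (col i))"

lemma fan_Suc: "fan p col (Suc k) b = fan p col k b \<inter> T (Suc k) p (col (Suc k))"
  by (auto simp: fan_def atMost_Suc)

lemma fan_closed:
  assumes "k < p" "p < m" "b \<in> binary" "\<And>i. i \<le> k \<Longrightarrow> col i \<in> binary"
  shows "fan p col k b \<in> K"
  using assms
proof (induction k)
  case 0
  then show ?case by (simp add: fan_def)
next
  case (Suc k)
  then show ?case by (simp add: fan_Suc)
qed

lemma fan_cong: "(\<And>i. i \<le> k \<Longrightarrow> col i = col' i) \<Longrightarrow> fan p col k b = fan p col' k b"
  by (auto simp: fan_def)

lemma fan_subset: "fan p col k b \<subseteq> T 0 p b" "i \<le> k \<Longrightarrow> fan p col k b \<subseteq> T i p (col i)"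
  by (auto simp: fan_def)

lemma c_fan:
  assumes "k < l" "l < p" "p < m" "b \<in> binary" "\<And>i. i \<le> k \<Longrightarrow> col i \<in> binary"
  shows "c l (fan p col k b) = fan p col k b"
  using assms
proof (induction k)
  case 0
  then show ?case by (simp add: fan_def c_int_closed c_T)
next
  case (Suc k)
  then show ?case by (simp add: fan_Suc c_int_closed c_T fan_closed)
qed

text \<open>Points 0, ..., k have been placed so that every edge from point i to a later one has colour
  \<open>col i\<close>, and for each \<open>b\<close> in \<open>B\<close> the spare coordinate \<open>p\<close> can be placed with its edge to
  point 0 in \<open>b\<close> and the edge to every point i coloured \<open>col i\<close>.\<close>

definition config :: "nat \<Rightarrow> 's set set \<Rightarrow> 's set set \<Rightarrow> nat \<Rightarrow> 's set \<Rightarrow> (nat \<Rightarrow> 's set) \<Rightarrow> 's set set \<Rightarrow> bool" where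
  "config p Q A k x col B \<longleftrightarrow> x \<in> K \<and> x \<noteq> {} \<and> B \<subseteq> A \<and> p ^ (p - 1 - k) \<le> card B \<and>
     (\<forall>i\<le>k. col i \<in> Q) \<and> (\<forall>j\<le>k. \<forall>i<j. x \<subseteq> T i j (col i)) \<and>
     (\<forall>l. k < l \<longrightarrow> l \<le> p \<longrightarrow> c l x = x) \<and> (\<forall>b\<in>B. x \<subseteq> c p (fan p col k b))"

text \<open>One neighbour \<open>b0\<close> is moved from the spare coordinate to the new
  coordinate. At a Stone point of the result every other neighbour gets a colour for its edge to the
  new point, and the most popular colour is kept.\<close>

lemma config_step:
  assumes m: "m = p + 1" and p: "4 \<le> p" and k: "Suc k < p"
    and A: "finite A" "A \<subseteq> binary" and disj: "\<And>a b. \<lbrakk>a \<in> A; b \<in> A; a \<noteq> b\<rbrakk> \<Longrightarrow> a \<inter> b = {}"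
    and Q: "finite Q" "Q \<subseteq> binary" "card Q < p" "U \<subseteq> d 0 1 \<union> \<Union>Q"
    and cfg: "config p Q A k x col B"
  shows "\<exists>x' col' B'. config p Q A (Suc k) x' col' B'"
proof -
  let ?l = "Suc k"
  have x: "x \<in> K" "x \<noteq> {}" and B: "B \<subseteq> A" and cardB: "p ^ (p - 1 - k) \<le> card B"
    and col: "\<And>i. i \<le> k \<Longrightarrow> col i \<in> Q" and edges: "\<And>i j. \<lbrakk>i < j; j \<le> k\<rbrakk> \<Longrightarrow> x \<subseteq> T i j (col i)"
    and cx: "\<And>l. \<lbrakk>k < l; l \<le> p\<rbrakk> \<Longrightarrow> c l x = x" and ext: "\<And>b. b \<in> B \<Longrightarrow> x \<subseteq> c p (fan p col k b)"
    using cfg by (auto simp: config_def)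
  have colb: "col i \<in> binary" if "i \<le> k" for i using col[OF that] Q by auto
  have Ab: "b \<in> binary" if "b \<in> B" for b using that A B by auto
  have fin: "finite B" using A B finite_subset by auto
  have fK: "fan p col k b \<in> K" if "b \<in> B" for b using fan_closed m k Ab colb that by simp
  have pe: "p - 1 - k = Suc (p - 1 - ?l)" using k by simp
  have "0 < card B" using cardB p by (metis gr0I le_zero_eq not_numeral_le_zero power_not_zero)
  then obtain b0 where b0: "b0 \<in> B" by (auto simp: card_gt_0_iff)
  define F where "F = fan p col k b0"
  have FK: "F \<in> K" using fK b0 F_def by simp
  have "c p (x \<inter> F) = x"
    using ext[OF b0] c_int_closed[of p F x] FK x cx[of p] k m by (auto simp: F_def Int_commute)
  then have ne: "x \<inter> F \<noteq> {}" using x c_empty[of p] m by auto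
  \<comment> \<open>\<open>F\<close> describes the neighbour \<open>b0\<close> at coordinate p; the
    substitution puts the same neighbour at the new coordinate and frees p for the others.\<close>
  define x' where "x' = x \<inter> s p ?l F"
  have x'K: "x' \<in> K" using x FK m k by (simp add: x'_def)
  have x'_eq: "x' = s p ?l (x \<inter> F)"
    using x FK m k cx[of p] by (simp add: x'_def s_int s_closed_elem)
  have "c ?l (x \<inter> F) = x \<inter> F"
    using c_int_closed[of ?l x F] cx[of ?l] x FK k m c_fan[of k ?l p b0 col] Ab[OF b0] colb
    by (simp add: F_def)
  \<comment> \<open>Renaming the bound coordinate turns the existence of \<open>b0\<close> at p into
    its existence at the new coordinate, so \<open>c ?l x'\<close> is \<open>x\<close> again and
    \<open>x'\<close> cannot be empty.\<close>
  then have "c ?l x' = c p (x \<inter> F)"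
    unfolding x'_eq using c_rename[of p ?l "x \<inter> F"] x FK k m by simp
  with \<open>c p (x \<inter> F) = x\<close> have "x' \<noteq> {}" using x c_empty[of ?l] m k by auto
  then obtain t where t: "t \<in> x'" by auto
  have edge_new: "x' \<subseteq> T i ?l (col i)" if "i \<le> k" for i
  proof -
    have "s p ?l F \<subseteq> s p ?l (T i p (col i))"
      using that k m p colb FK unfolding F_def
      by (intro s_mono fan_subset) auto
    then show ?thesis using s_T[of i p ?l "col i"] that k m p colb by (auto simp: x'_def)
  qed
  have edge_b0: "x' \<subseteq> T 0 ?l b0"
  proof -
    have "s p ?l F \<subseteq> s p ?l (T 0 p b0)"
      using k m p Ab[OF b0] FK unfolding F_def
      by (intro s_mono fan_subset) auto
    then show ?thesis using s_T[of 0 p ?l b0] k m p Ab[OF b0] by (auto simp: x'_def)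
  qed
  have cx': "c l x' = x'" if "?l < l" "l \<le> p" for l
  proof (cases "l = p")
    case True
    then show ?thesis using x FK m k cx[of p] c_s[of p ?l F]
      by (simp add: x'_def c_int_closed)
  next
    case False
    then have "c l F = F" using that k m Ab[OF b0] colb unfolding F_def by (intro c_fan) auto
    then show ?thesis using that False x FK m k cx[of l] c_s_other[of p ?l l F]
      by (simp add: x'_def c_int_closed)
  qed
  \<comment> \<open>The colour may depend on the Stone point, hence the claim is about the fixed
    \<open>t\<close> and not about all of \<open>x'\<close>.\<close>
  have "\<exists>q\<in>Q. t \<in> c p (fan p col k b \<inter> T ?l p q)" if b: "b \<in> B - {b0}" for b
  proof -
    let ?Y = "x' \<inter> fan p col k b"
    have bB: "b \<in> B" "b \<noteq> b0" using b by auto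
    have bb: "b \<in> binary" "b0 \<in> binary" using Ab bB b0 by auto
    have YK: "?Y \<in> K" using x'K fK bB by simp
    have "c p ?Y = c p (fan p col k b) \<inter> x'"
      using c_int_closed[of p "fan p col k b" x'] fK bB x'K cx'[of p] k m by (simp add: Int_commute)
    then have tY: "t \<in> c p ?Y" using t ext[OF bB(1)] x'_def by auto
    have dK: "d 0 1 \<in> K" using m p by simp
    have T_d01: "T ?l p (d 0 1) = d ?l p" using T_d k m by simp
    \<comment> \<open>On the diagonal the neighbour for \<open>b\<close> would coincide with the new
      point, and their common edge to point 0 would lie in the disjoint labels \<open>b0\<close> and
      \<open>b\<close>. Only diversity colours remain for the edge between them.\<close>
    have empty: "?Y \<inter> d ?l p = {}"
    proof -
      have "?Y \<inter> d ?l p \<subseteq> T 0 ?l b0 \<inter> (d p ?l \<inter> T 0 p b)"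
        using edge_b0 fan_subset(1)[of p col k b] d_sym[of ?l p] k m by auto
      also have "\<dots> = T 0 ?l b0 \<inter> (d p ?l \<inter> T 0 ?l b)"
        using d_int_T[of 0 p ?l b] k m p bb by simp
      also have "\<dots> \<subseteq> T 0 ?l (b0 \<inter> b)" using T_int k m bb binaryD by auto
      also have "\<dots> = {}" using disj[of b0 b] bB b0 B T_empty[of 0 ?l] k m by (simp add: subset_iff)
      finally show ?thesis by simp
    qed
    have QT: "U \<subseteq> d ?l p \<union> \<Union>(T ?l p ` Q)"
    proof -
      \<comment> \<open>Transport is known to respect only binary unions, so the cover by
        \<open>Q\<close> is carried over by induction on finite subfamilies.\<close>
      have *: "\<Union>R \<in> K \<and> T ?l p (\<Union>R) = \<Union>(T ?l p ` R)" if "finite R" "R \<subseteq> Q" for R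
        using that
      proof (induction R)
        case empty
        have "{} = U - U" by simp
        then have "{} \<in> K" using U_closed[of 0] m compl_closed[of U] by simp
        then show ?case using T_empty[of ?l p] k m by simp
      next
        case (insert q R)
        then have "q \<in> K" using Q binaryD by auto
        with insert show ?case using T_un[of ?l p q "\<Union>R"] k m by simp
      qed
      have U: "U = d 0 1 \<union> \<Union>Q" using Q(4) sub_U[OF dK] sub_U *[OF Q(1)] by blast
      have "U = T ?l p U" using T_U k m by simp
      also have "\<dots> = T ?l p (d 0 1 \<union> \<Union>Q)" using U by (rule arg_cong)
      also have "\<dots> = d ?l p \<union> \<Union>(T ?l p ` Q)"
        using *[OF Q(1)] dK T_un[of ?l p "d 0 1" "\<Union>Q"] k m T_d01 by simp
      finally show ?thesis by simp
    qed
    have "\<exists>y\<in>T ?l p ` Q. t \<in> c p (?Y \<inter> y)"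
    proof (rule c_Union_subset)
      show "?Y \<subseteq> \<Union>(T ?l p ` Q)" using QT empty sub_U[OF YK] by blast
      show "T ?l p ` Q \<subseteq> K" using Q k m by auto
    qed (use YK tY Q m in auto)
    then obtain q where q: "q \<in> Q" "t \<in> c p (?Y \<inter> T ?l p q)" by auto
    have "q \<in> binary" using q Q by auto
    then have "c p (?Y \<inter> T ?l p q) \<subseteq> c p (fan p col k b \<inter> T ?l p q)"
      using YK fK bB k m by (intro c_mono) auto
    with q show ?thesis by blast
  qed
  then obtain f where f: "\<And>b. b \<in> B - {b0} \<Longrightarrow> f b \<in> Q"
      "\<And>b. b \<in> B - {b0} \<Longrightarrow> t \<in> c p (fan p col k b \<inter> T ?l p (f b))"
    by metis
  obtain q where q: "q \<in> Q" "p ^ (p - 1 - ?l) \<le> card {b \<in> B - {b0}. f b = q}"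
  proof (rule pigeonhole_power)
    show "f ` (B - {b0}) \<subseteq> Q" using f by auto
    show "p ^ Suc (p - 1 - ?l) - 1 \<le> card (B - {b0})"
      using cardB pe b0 fin by (simp add: card_Diff_singleton)
  qed (use fin Q p in auto)
  define B' where "B' = {b \<in> B - {b0}. f b = q}"
  define G where "G = (\<lambda>b. c p (fan p col k b \<inter> T ?l p q))"
  define col' where "col' = col(?l := q)"
  have GK: "G b \<in> K" if "b \<in> B'" for b
    using that fK k m q Q by (auto simp: G_def B'_def subset_iff)
  have fan': "fan p col' ?l b = fan p col k b \<inter> T ?l p q" for b
    using fan_cong[of k col' col] by (simp add: fan_Suc col'_def)
  have cG: "c l (G b) = G b" if "b \<in> B'" "?l < l" "l \<le> p" for b l
  proof (cases "l = p")
    case True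
    then show ?thesis using that fK[of b] k m q Q
      by (auto simp: G_def B'_def subset_iff c_idem)
  next
    case False
    have "b \<in> B" using that by (simp add: B'_def)
    have qb: "q \<in> binary" using q Q by auto
    have "c l (fan p col k b \<inter> T ?l p q) = fan p col k b \<inter> T ?l p q"
      using False that \<open>b \<in> B\<close> qb fK[of b] k m c_fan[of k l p b col] Ab colb
      by (simp add: c_int_closed c_T)
    then show ?thesis using c_comm[of l p] that fK[OF \<open>b \<in> B\<close>] qb k m by (simp add: G_def)
  qed
  \<comment> \<open>\<open>x'\<close> is cut down to the region where all surviving neighbours exist
    with the chosen colour \<open>q\<close>. The finite intersection stays in \<open>K\<close> and
    is nonempty since \<open>t\<close> lies in every \<open>G b\<close>.\<close>
  have "\<exists>y\<in>K. t \<in> y \<and> y \<subseteq> x' \<and> (\<forall>l. ?l < l \<longrightarrow> l \<le> p \<longrightarrow> c l y = y) \<and> (\<forall>b\<in>R. y \<subseteq> G b)"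
    if "finite R" "R \<subseteq> B'" for R
    using that
  proof (induction R)
    case empty
    show ?case using t x'K cx' by auto
  next
    case (insert b R)
    then obtain y where y: "y \<in> K" "t \<in> y" "y \<subseteq> x'" "\<forall>l. ?l < l \<longrightarrow> l \<le> p \<longrightarrow> c l y = y" "\<forall>b\<in>R. y \<subseteq> G b"
      by auto
    have bB': "b \<in> B'" using insert by simp
    have "t \<in> G b" using f(2)[of b] bB' by (simp add: G_def B'_def)
    show ?case
    proof (intro bexI conjI allI impI ballI)
      show "y \<inter> G b \<in> K" using y(1) GK[OF bB'] by simp
      show "t \<in> y \<inter> G b" using y(2) \<open>t \<in> G b\<close> by blast
      show "y \<inter> G b \<subseteq> x'" using y(3) by blast
      show "c l (y \<inter> G b) = y \<inter> G b" if "?l < l" "l \<le> p" for l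
        using c_int_closed[of l y "G b"] y(1,4) GK[OF bB'] cG[OF bB' that] that m by simp
      show "y \<inter> G b \<subseteq> G b'" if "b' \<in> insert b R" for b' using that y(5) by blast
    qed
  qed
  from this[of B'] obtain y where y: "y \<in> K" "t \<in> y" "y \<subseteq> x'"
      "\<And>l. \<lbrakk>?l < l; l \<le> p\<rbrakk> \<Longrightarrow> c l y = y" "\<And>b. b \<in> B' \<Longrightarrow> y \<subseteq> G b"
    using fin by (auto simp: B'_def)
  have "config p Q A ?l y col' B'"
    unfolding config_def
  proof (intro conjI allI impI ballI)
    show "y \<in> K" "y \<noteq> {}" using y by auto
    show "B' \<subseteq> A" using B B'_def by auto
    show "p ^ (p - 1 - ?l) \<le> card B'" using q B'_def by simp
    show "col' i \<in> Q" if "i \<le> ?l" for i using that col q by (auto simp: col'_def)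
    show "y \<subseteq> T i j (col' i)" if "j \<le> ?l" "i < j" for i j
    proof (cases "j = ?l")
      case True
      then show ?thesis using that y(3) edge_new[of i] by (auto simp: col'_def)
    next
      case False
      then have "x \<subseteq> T i j (col i)" "i \<le> k" using that edges[of i j] by auto
      then show ?thesis using y(3) x'_def by (auto simp: col'_def)
    qed
    show "c l y = y" if "?l < l" "l \<le> p" for l using y(4) that .
    show "y \<subseteq> c p (fan p col' ?l b)" if "b \<in> B'" for b
      using y(5)[OF that] by (simp add: fan' G_def)
  qed
  then show ?thesis by blast
qed

text \<open>The term \<open>c 2 (T 0 2 a \<inter> T 1 2 a)\<close> is the relative product of
  \<open>a\<close> with itself, so \<open>refl\<close> says that the identity lies below it and
  \<open>no_mono\<close> excludes 1-cycles.\<close>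

theorem no_splitting:
  assumes m: "m = p + 1" and p: "4 \<le> p" and ne: "U \<noteq> {}"
    and A: "finite A" "A \<subseteq> binary" and disj: "\<And>a b. \<lbrakk>a \<in> A; b \<in> A; a \<noteq> b\<rbrakk> \<Longrightarrow> a \<inter> b = {}"
    and refl: "\<And>a. a \<in> A \<Longrightarrow> d 0 1 \<subseteq> c 2 (T 0 2 a \<inter> T 1 2 a)"
    and Q: "finite Q" "Q \<subseteq> binary" "card Q < p" "U \<subseteq> d 0 1 \<union> \<Union>Q"
    and no_mono: "\<And>q. q \<in> Q \<Longrightarrow> q \<inter> c 2 (T 0 2 q \<inter> T 1 2 q) = {}"
    and u: "u \<in> Q" "\<And>a. a \<in> A \<Longrightarrow> a \<subseteq> u" and large: "p ^ (p - 1) \<le> card A"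
  shows False
proof -
  \<comment> \<open>Every point has a neighbour along \<open>a\<close>: since the identity lies
    below the square of \<open>a\<close>, the diagonal is contained in \<open>c p (T 0 p a)\<close>.
    That set does not depend on coordinate 1, and cylindrifying the diagonal by 1 gives
    \<open>U\<close>.\<close>
  have ext: "U = c p (T 0 p a)" if "a \<in> A" for a
  proof -
    have ab: "a \<in> binary" using that A by auto
    have TK: "T 0 p a \<in> K" "T 1 p a \<in> K" using ab m p by simp_all
    have "c 2 (T 0 2 a \<inter> T 1 2 a) = c p (T 0 p a \<inter> T 1 p a)"
      using T_comp[of 0 1 p a a] ab m p by (simp add: T_0_1)
    also have "\<dots> \<subseteq> c p (T 0 p a)" using TK m by (intro c_mono) auto
    finally have "d 0 1 \<subseteq> c p (T 0 p a)" using refl[OF that] by blast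
    then have "c 1 (d 0 1) \<subseteq> c 1 (c p (T 0 p a))" using TK m p by (intro c_mono) auto
    also have "\<dots> = c p (T 0 p a)" using c_comm[of 1 p "T 0 p a"] TK ab m p by (simp add: c_T)
    finally show ?thesis using c_d_right[of 0 1] sub_U[of "c p (T 0 p a)"] TK m p by auto
  qed
  have "config p Q A 0 U (\<lambda>_. u) A"
    unfolding config_def
  proof (intro conjI allI impI ballI)
    show "U \<in> K" using U_closed m by auto
    show "c l U = U" if "0 < l" "l \<le> p" for l using c_U that m by simp
    show "U \<subseteq> c p (fan p (\<lambda>_. u) 0 b)" if "b \<in> A" for b
    proof -
      have "T 0 p b \<subseteq> T 0 p u" using that A Q u m p by (intro T_mono) auto
      then have "fan p (\<lambda>_. u) 0 b = T 0 p b" by (auto simp: fan_def)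
      then show ?thesis using ext[OF that] by simp
    qed
  qed (use ne u large in auto)
  moreover have "k < p \<Longrightarrow> \<exists>x col B. config p Q A k x col B" if "\<exists>x col B. config p Q A 0 x col B" for k
  proof (induction k)
    case (Suc k)
    then obtain x col B where "config p Q A k x col B" by auto
    then show ?case using config_step[OF m p _ A disj Q] Suc.prems by blast
  qed (use that in blast)
  \<comment> \<open>At k = p - 1 the lower bound on \<open>card B\<close> is p^0 = 1, so one
    neighbour is left to take coordinate p as the final point.\<close>
  ultimately obtain x col B where "config p Q A (p - 1) x col B" using p by (metis diff_less zero_less_one zero_less_numeral order_less_le_trans)
  then have x: "x \<in> K" "x \<noteq> {}" and B: "B \<subseteq> A" "1 \<le> card B"
    and col: "\<And>i. i \<le> p - 1 \<Longrightarrow> col i \<in> Q"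
    and edges: "\<And>i j. \<lbrakk>i < j; j \<le> p - 1\<rbrakk> \<Longrightarrow> x \<subseteq> T i j (col i)"
    and cx: "c p x = x" and fan: "\<And>b. b \<in> B \<Longrightarrow> x \<subseteq> c p (fan p col (p - 1) b)"
    using p by (auto simp: config_def)
  obtain b where b: "b \<in> B" using B(2) by fastforce
  have bb: "b \<in> binary" using b B A by auto
  let ?F = "fan p col (p - 1) b"
  have FK: "?F \<in> K" using fan_closed[of "p - 1" p b col] col Q bb m p by auto
  have "c p (?F \<inter> x) = c p ?F \<inter> x" using c_int_closed[of p ?F x] FK x cx m by simp
  also have "\<dots> \<noteq> {}" using fan[OF b] x by auto
  finally have "?F \<inter> x \<noteq> {}" using c_empty[of p] m by auto
  then obtain t where t: "t \<in> ?F" "t \<in> x" by auto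
  \<comment> \<open>Equal colours would make the edges ij, ip and jp all equal to \<open>q\<close>.
    By \<open>T_comp\<close>, \<open>t\<close> would then lie in the transport of the meet of
    \<open>q\<close> with its square, which is empty.\<close>
  have neq: "col i \<noteq> col j" if "i < j" "j \<le> p - 1" for i j
  proof
    assume eq: "col i = col j"
    define q where "q = col i"
    have qQ: "q \<in> Q" using col that by (auto simp: q_def)
    then have qb: "q \<in> binary" using Q by auto
    have "t \<in> T i p q" "t \<in> T j p q" "t \<in> T i j q"
      using fan_subset(2)[of i "p - 1" p col b] fan_subset(2)[of j "p - 1" p col b] edges[OF that] t that eq
      by (auto simp: q_def)
    moreover have "T i p q \<inter> T j p q \<subseteq> c p (T i p q \<inter> T j p q)"
      using that m p qb by (intro c_incr) auto
    moreover have "c p (T i p q \<inter> T j p q) = T i j (c 2 (T 0 2 q \<inter> T 1 2 q))"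
      using T_comp[of i j p q q] that m p qb by simp
    ultimately have "t \<in> T i j (q \<inter> c 2 (T 0 2 q \<inter> T 1 2 q))"
      using T_int[of i j q "c 2 (T 0 2 q \<inter> T 1 2 q)"] that m p qb binaryD(1)[OF qb] by auto
    then show False using no_mono[OF qQ] T_empty that m p by simp
  qed
  have "inj_on col {..<p}"
  proof (rule inj_onI, rule ccontr)
    fix i j assume "i \<in> {..<p}" "j \<in> {..<p}" and eq: "col i = col j" "i \<noteq> j"
    then have le: "i \<le> p - 1" "j \<le> p - 1" by auto
    from eq(2) consider "i < j" | "j < i" by linarith
    then show False using neq le eq(1) by cases metis+
  qed
  moreover have "col ` {..<p} \<subseteq> Q" using col by force
  ultimately have "p \<le> card Q"
    using card_inj_on_le[of col "{..<p}" Q] Q(1) by simp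
  with Q(3) show False by simp
qed

end

section \<open>Symmetric nonassociative algebras in cylindric algebras\<close>

lemma is_CA_D [rule_format]:
  assumes "is_CA m D"
  shows "0 < m" and "ca_carrier D \<noteq> {}"
    and "\<forall>x\<in>ca_carrier D. \<forall>y\<in>ca_carrier D. ca_plus D x y \<in> ca_carrier D"
    and "\<forall>x\<in>ca_carrier D. ca_cmp D x \<in> ca_carrier D"
    and "\<forall>i<m. \<forall>x\<in>ca_carrier D. ca_cyl D i x \<in> ca_carrier D"
    and "\<forall>i<m. \<forall>j<m. ca_diag D i j \<in> ca_carrier D"
    and "\<forall>x\<in>ca_carrier D. \<forall>y\<in>ca_carrier D. \<forall>z\<in>ca_carrier D.
        ca_plus D x y = ca_plus D y x \<and>
        ca_plus D x (ca_plus D y z) = ca_plus D (ca_plus D x y) z \<and>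
        ca_plus D (ca_cmp D (ca_plus D (ca_cmp D x) y))
                  (ca_cmp D (ca_plus D (ca_cmp D x) (ca_cmp D y))) = x"
    and "\<forall>i<m. ca_cyl D i (ca_zero D) = ca_zero D"
    and "\<forall>i<m. \<forall>x\<in>ca_carrier D. ca_le D x (ca_cyl D i x)"
    and "\<forall>i<m. \<forall>x\<in>ca_carrier D. \<forall>y\<in>ca_carrier D.
        ca_cyl D i (ca_meet D x (ca_cyl D i y)) = ca_meet D (ca_cyl D i x) (ca_cyl D i y)"
    and "\<forall>i<m. \<forall>j<m. \<forall>x\<in>ca_carrier D. ca_cyl D i (ca_cyl D j x) = ca_cyl D j (ca_cyl D i x)"
    and "\<forall>i<m. ca_diag D i i = ca_top D"
    and "\<forall>i<m. \<forall>j<m. \<forall>k<m. k \<noteq> i \<and> k \<noteq> j \<longrightarrow>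
        ca_diag D i j = ca_cyl D k (ca_meet D (ca_diag D i k) (ca_diag D k j))"
    and "\<forall>i<m. \<forall>j<m. \<forall>x\<in>ca_carrier D. i \<noteq> j \<longrightarrow>
        ca_meet D (ca_cyl D i (ca_meet D (ca_diag D i j) x))
                  (ca_cyl D i (ca_meet D (ca_diag D i j) (ca_cmp D x))) = ca_zero D"
  using assms unfolding is_CA_def by - (elim conjE, assumption)+

lemma is_NA_D [rule_format]:
  assumes "is_NA A"
  shows "ra_carrier A \<noteq> {}"
    and "\<forall>x\<in>ra_carrier A. \<forall>y\<in>ra_carrier A.
        ra_plus A x y \<in> ra_carrier A \<and> ra_comp A x y \<in> ra_carrier A"
    and "\<forall>x\<in>ra_carrier A. ra_cmp A x \<in> ra_carrier A \<and> ra_conv A x \<in> ra_carrier A"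
    and "ra_ident A \<in> ra_carrier A"
    and "\<forall>x\<in>ra_carrier A. \<forall>y\<in>ra_carrier A. \<forall>z\<in>ra_carrier A.
        ra_plus A x y = ra_plus A y x \<and>
        ra_plus A x (ra_plus A y z) = ra_plus A (ra_plus A x y) z \<and>
        ra_plus A (ra_cmp A (ra_plus A (ra_cmp A x) y))
                  (ra_cmp A (ra_plus A (ra_cmp A x) (ra_cmp A y))) = x \<and>
        ra_comp A (ra_plus A x y) z = ra_plus A (ra_comp A x z) (ra_comp A y z) \<and>
        ra_comp A x (ra_ident A) = x \<and>
        ra_conv A (ra_conv A x) = x \<and>
        ra_conv A (ra_plus A x y) = ra_plus A (ra_conv A x) (ra_conv A y) \<and>
        ra_conv A (ra_comp A x y) = ra_comp A (ra_conv A y) (ra_conv A x) \<and>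
        ra_plus A (ra_comp A (ra_conv A x) (ra_cmp A (ra_comp A x y))) (ra_cmp A y)
          = ra_cmp A y"
  using assms unfolding is_NA_def by - (elim conjE, assumption)+

lemma CA_huntington:
  assumes "is_CA m D"
  shows "huntington (ca_carrier D) (ca_plus D) (ca_cmp D)"
proof
  show "ca_plus D x y = ca_plus D y x" if "x \<in> ca_carrier D" "y \<in> ca_carrier D" for x y
    using is_CA_D(7)[OF assms that that(1)] by (elim conjE)
  show "ca_plus D (ca_plus D x y) z = ca_plus D x (ca_plus D y z)"
    if "x \<in> ca_carrier D" "y \<in> ca_carrier D" "z \<in> ca_carrier D" for x y z
    using is_CA_D(7)[OF assms that] by (elim conjE) (rule sym)
  show "ca_plus D (ca_cmp D (ca_plus D (ca_cmp D x) y))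
      (ca_cmp D (ca_plus D (ca_cmp D x) (ca_cmp D y))) = x"
    if "x \<in> ca_carrier D" "y \<in> ca_carrier D" for x y
    using is_CA_D(7)[OF assms that that(1)] by (elim conjE)
qed (fact is_CA_D[OF assms])+

lemma NA_huntington:
  assumes "is_NA A"
  shows "huntington (ra_carrier A) (ra_plus A) (ra_cmp A)"
proof
  show "ra_plus A x y = ra_plus A y x" if "x \<in> ra_carrier A" "y \<in> ra_carrier A" for x y
    using is_NA_D(5)[OF assms that that(1)] by (elim conjE)
  show "ra_plus A (ra_plus A x y) z = ra_plus A x (ra_plus A y z)"
    if "x \<in> ra_carrier A" "y \<in> ra_carrier A" "z \<in> ra_carrier A" for x y z
    using is_NA_D(5)[OF assms that] by (elim conjE) (rule sym)
  show "ra_plus A (ra_cmp A (ra_plus A (ra_cmp A x) y))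
      (ra_cmp A (ra_plus A (ra_cmp A x) (ra_cmp A y))) = x"
    if "x \<in> ra_carrier A" "y \<in> ra_carrier A" for x y
    using is_NA_D(5)[OF assms that that(1)] by (elim conjE)
qed (use is_NA_D(1-3)[OF assms] in auto)

lemma CA_representation:
  fixes D :: "('b, 'n) ca_alg_scheme"
  assumes CA: "is_CA m D"
  obtains U :: "'b set set" and \<phi> and c where
    "cylindric_field m U (\<phi> ` ca_carrier D) c (\<lambda>i j. \<phi> (ca_diag D i j))"
    "inj_on \<phi> (ca_carrier D)"
    "\<And>x y. \<lbrakk>x \<in> ca_carrier D; y \<in> ca_carrier D\<rbrakk> \<Longrightarrow> \<phi> (ca_plus D x y) = \<phi> x \<union> \<phi> y"
    "\<And>x. x \<in> ca_carrier D \<Longrightarrow> \<phi> (ca_cmp D x) = U - \<phi> x"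
    "\<And>i x. \<lbrakk>i < m; x \<in> ca_carrier D\<rbrakk> \<Longrightarrow> c i (\<phi> x) = \<phi> (ca_cyl D i x)"
proof -
  interpret huntington "ca_carrier D" "ca_plus D" "ca_cmp D"
    using CA by (rule CA_huntington)
  define \<phi> where "\<phi> = stone"
  define U where "U = maximal_ideals"
  \<comment> \<open>Off the image of \<open>\<phi>\<close> the values are arbitrary; the cylindric
    laws are required only on the image, where \<open>inv_into\<close> recovers the unique
    preimage.\<close>
  define c where "c i X = \<phi> (ca_cyl D i (inv_into (ca_carrier D) \<phi> X))" for i X
  let ?C = "ca_carrier D"
  have inj: "inj_on \<phi> ?C" using stone_inj by (simp add: \<phi>_def)
  have plus: "\<phi> (ca_plus D x y) = \<phi> x \<union> \<phi> y" if "x \<in> ?C" "y \<in> ?C" for x y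
    using that by (simp add: \<phi>_def stone_plus)
  have cmp: "\<phi> (ca_cmp D x) = U - \<phi> x" if "x \<in> ?C" for x
    using that by (simp add: \<phi>_def U_def stone_neg)
  have c: "c i (\<phi> x) = \<phi> (ca_cyl D i x)" if "x \<in> ?C" for i x
    using that inj by (simp add: c_def)
  have sub: "\<phi> x \<subseteq> U" for x using stone_subset by (simp add: \<phi>_def U_def)
  have meetC: "ca_meet D x y \<in> ?C" if "x \<in> ?C" "y \<in> ?C" for x y
    using that by (simp add: ca_meet_def)
  have meet: "\<phi> (ca_meet D x y) = \<phi> x \<inter> \<phi> y" if "x \<in> ?C" "y \<in> ?C" for x y
    using that sub[of x] sub[of y] by (auto simp: ca_meet_def plus cmp)
  have m: "0 < m" and cylC: "\<And>i x. \<lbrakk>i < m; x \<in> ?C\<rbrakk> \<Longrightarrow> ca_cyl D i x \<in> ?C"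
    and diagC: "\<And>i j. \<lbrakk>i < m; j < m\<rbrakk> \<Longrightarrow> ca_diag D i j \<in> ?C"
    using is_CA_D(1,5,6)[OF CA] by auto
  have top: "\<phi> (ca_top D) = U" using diagC[OF m m] sub[of "ca_diag D 0 0"]
    by (auto simp: ca_top_def plus cmp)
  have zero: "\<phi> (ca_zero D) = {}" "ca_zero D \<in> ?C" using diagC[OF m m]
    by (auto simp: ca_zero_def plus cmp)
  have "cylindric_field m U (\<phi> ` ?C) c (\<lambda>i j. \<phi> (ca_diag D i j))"
  proof
    fix x assume "x \<in> \<phi> ` ?C" then show "x \<subseteq> U" using sub by auto
  next
    fix x y assume "x \<in> \<phi> ` ?C" "y \<in> \<phi> ` ?C" then show "x \<union> y \<in> \<phi> ` ?C"
      by (auto simp: plus[symmetric])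
  next
    fix x assume "x \<in> \<phi> ` ?C" then show "U - x \<in> \<phi> ` ?C" by (auto simp: cmp[symmetric])
  next
    fix i x assume "i < m" "x \<in> \<phi> ` ?C" then show "c i x \<in> \<phi> ` ?C" by (auto simp: c cylC)
  next
    fix i j assume "i < m" "j < m" then show "\<phi> (ca_diag D i j) \<in> \<phi> ` ?C" by (simp add: diagC)
  next
    fix i assume "i < m"
    then have "ca_cyl D i (ca_zero D) = ca_zero D" using is_CA_D(8)[OF CA] by simp
    then show "c i {} = {}" using c[OF zero(2), of i] zero by simp
  next
    fix i x assume i: "i < m" and "x \<in> \<phi> ` ?C"
    then obtain x' where x': "x' \<in> ?C" "x = \<phi> x'" by auto
    then have "ca_plus D x' (ca_cyl D i x') = ca_cyl D i x'" using is_CA_D(9)[OF CA i] by (simp add: ca_le_def)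
    then have "\<phi> x' \<union> \<phi> (ca_cyl D i x') = \<phi> (ca_cyl D i x')" using plus[OF x'(1) cylC[OF i x'(1)]] by simp
    then show "x \<subseteq> c i x" using x' c by auto
  next
    fix i x y assume i: "i < m" and "x \<in> \<phi> ` ?C" "y \<in> \<phi> ` ?C"
    then obtain x' y' where x': "x' \<in> ?C" "x = \<phi> x'" "y' \<in> ?C" "y = \<phi> y'" by auto
    have "ca_cyl D i (ca_meet D x' (ca_cyl D i y')) = ca_meet D (ca_cyl D i x') (ca_cyl D i y')"
      using is_CA_D(10)[OF CA i] x' by simp
    then show "c i (x \<inter> c i y) = c i x \<inter> c i y"
      using x' i by (simp add: c cylC meet[symmetric] meetC)
  next
    fix i j x assume ij: "i < m" "j < m" and "x \<in> \<phi> ` ?C"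
    then obtain x' where x': "x' \<in> ?C" "x = \<phi> x'" by auto
    have "ca_cyl D i (ca_cyl D j x') = ca_cyl D j (ca_cyl D i x')"
      using is_CA_D(11)[OF CA ij] x' by simp
    then show "c i (c j x) = c j (c i x)" using x' ij by (simp add: c cylC)
  next
    fix i assume "i < m"
    then have "ca_diag D i i = ca_top D" using is_CA_D(12)[OF CA] by simp
    then show "\<phi> (ca_diag D i i) = U" using top by simp
  next
    fix i j k assume ijk: "i < m" "j < m" "k < m" "k \<noteq> i" "k \<noteq> j"
    then have "ca_diag D i j = ca_cyl D k (ca_meet D (ca_diag D i k) (ca_diag D k j))"
      using is_CA_D(13)[OF CA] by simp
    then show "\<phi> (ca_diag D i j) = c k (\<phi> (ca_diag D i k) \<inter> \<phi> (ca_diag D k j))"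
      using ijk by (simp add: meet[symmetric] diagC c meetC)
  next
    fix i j x assume ij: "i < m" "j < m" "i \<noteq> j" and "x \<in> \<phi> ` ?C"
    then obtain x' where x': "x' \<in> ?C" "x = \<phi> x'" by auto
    have "ca_meet D (ca_cyl D i (ca_meet D (ca_diag D i j) x'))
                  (ca_cyl D i (ca_meet D (ca_diag D i j) (ca_cmp D x'))) = ca_zero D"
      using is_CA_D(14)[OF CA] ij x' by simp
    then show "c i (\<phi> (ca_diag D i j) \<inter> x) \<inter> c i (\<phi> (ca_diag D i j) \<inter> (U - x)) = {}"
      using x' ij zero(1) by (simp add: cmp[symmetric] meet[symmetric] c diagC meetC cylC)
  qed
  then show ?thesis using that inj plus cmp c by blast
qed

text \<open>Here \<open>g\<close> represents only the Boolean operations. This lets the locale serve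
  both for the map induced by an embedding into \<open>Ra\<close> and for the Stone map of
  \<open>A\<close> itself.\<close>

locale sym_NA_rep =
  fixes A :: "('a, 'm) ra_alg_scheme" and U :: "'s set" and g :: "'a \<Rightarrow> 's set"
  assumes NA: "is_NA A"
    and sym: "symmetric_on A (ra_carrier A)"
    and ident_atom: "ra_ident A \<in> ra_atoms A"
    and inj: "inj_on g (ra_carrier A)"
    and g_plus: "\<lbrakk>x \<in> ra_carrier A; y \<in> ra_carrier A\<rbrakk> \<Longrightarrow> g (ra_plus A x y) = g x \<union> g y"
    and g_cmp: "x \<in> ra_carrier A \<Longrightarrow> g (ra_cmp A x) = U - g x"
    and g_sub: "x \<in> ra_carrier A \<Longrightarrow> g x \<subseteq> U"
begin

abbreviation carr ("\<C>") where "\<C> \<equiv> ra_carrier A"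
abbreviation rel_prod (infixl "\<odot>" 70) where "x \<odot> y \<equiv> ra_comp A x y"
abbreviation ident ("\<one>") where "\<one> \<equiv> ra_ident A"

section \<open>Arithmetic of symmetric nonassociative algebras\<close>

lemma closed [simp]:
  "\<one> \<in> \<C>" "\<lbrakk>x \<in> \<C>; y \<in> \<C>\<rbrakk> \<Longrightarrow> ra_plus A x y \<in> \<C>" "\<lbrakk>x \<in> \<C>; y \<in> \<C>\<rbrakk> \<Longrightarrow> x \<odot> y \<in> \<C>"
  "x \<in> \<C> \<Longrightarrow> ra_cmp A x \<in> \<C>"
  using is_NA_D(2-4)[OF NA] by auto

lemma conv_eq: "x \<in> \<C> \<Longrightarrow> ra_conv A x = x"
  using sym by (simp add: symmetric_on_def)

lemma g_le: "\<lbrakk>x \<in> \<C>; y \<in> \<C>\<rbrakk> \<Longrightarrow> ra_le A x y \<longleftrightarrow> g x \<subseteq> g y"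
  unfolding ra_le_def using g_plus[of x y] inj_onD[OF inj, of "ra_plus A x y" y] by auto

lemma g_meet: "\<lbrakk>x \<in> \<C>; y \<in> \<C>\<rbrakk> \<Longrightarrow> g (ra_meet A x y) = g x \<inter> g y"
  using g_sub[of x] by (auto simp: ra_meet_def g_plus g_cmp)

lemma meet_closed [simp]: "\<lbrakk>x \<in> \<C>; y \<in> \<C>\<rbrakk> \<Longrightarrow> ra_meet A x y \<in> \<C>"
  by (simp add: ra_meet_def)

lemma zero_closed [simp]: "ra_zero A \<in> \<C>"
  by (simp add: ra_zero_def)

lemma g_zero: "g (ra_zero A) = {}"
  by (auto simp: ra_zero_def g_plus g_cmp)

lemma g_eq_empty: "x \<in> \<C> \<Longrightarrow> g x = {} \<longleftrightarrow> x = ra_zero A"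
  using inj_onD[OF inj, of x "ra_zero A"] g_zero by auto

lemma g_diversity: "g (ra_diversity A) = U - g \<one>"
  by (simp add: ra_diversity_def g_cmp)

lemma atom_nonempty: "\<lbrakk>S \<subseteq> \<C>; e \<in> ra_atoms_in A S\<rbrakk> \<Longrightarrow> g e \<noteq> {}"
  using g_eq_empty by (auto simp: ra_atoms_in_def)

lemma atom_dichotomy:
  assumes "is_subuniverse A S" "e \<in> ra_atoms_in A S" "x \<in> S"
  shows "g e \<subseteq> g x \<or> g e \<inter> g x = {}"
proof -
  have S: "S \<subseteq> \<C>" "ra_meet A x e \<in> S" "e \<in> S"
    using assms by (auto simp: is_subuniverse_def ra_meet_def ra_atoms_in_def)
  then have C: "e \<in> \<C>" "x \<in> \<C>" using assms by auto
  then have "ra_le A (ra_meet A x e) e" by (simp add: g_le g_meet)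
  then have "ra_meet A x e = ra_zero A \<or> ra_meet A x e = e"
    using assms S unfolding ra_atoms_in_def by blast
  then show ?thesis using g_meet[OF C(2,1)] g_zero by auto
qed

text \<open>Take a minimal \<open>g e\<close> containing \<open>t\<close>. For \<open>y\<close>
  below \<open>e\<close>, either \<open>y\<close> or its complement in \<open>e\<close> contains
  \<open>t\<close>, and minimality makes that part all of \<open>e\<close>.\<close>

lemma atom_through_point:
  assumes S: "is_subuniverse A S" and "finite S" "t \<in> U"
  obtains e where "e \<in> ra_atoms_in A S" "t \<in> g e"
proof -
  have SC: "S \<subseteq> \<C>" and ident: "\<one> \<in> S" and plus: "\<And>x y. \<lbrakk>x \<in> S; y \<in> S\<rbrakk> \<Longrightarrow> ra_plus A x y \<in> S"
    and cmp: "\<And>x. x \<in> S \<Longrightarrow> ra_cmp A x \<in> S"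
    using S by (auto simp: is_subuniverse_def)
  define F where "F = g ` {x \<in> S. t \<in> g x}"
  have "ra_plus A \<one> (ra_cmp A \<one>) \<in> S" "t \<in> g (ra_plus A \<one> (ra_cmp A \<one>))"
    using ident plus cmp assms(3) by (auto simp: g_plus g_cmp)
  then have "F \<noteq> {}" "finite F" using assms(2) by (auto simp: F_def)
  then obtain X where X: "X \<in> F" "\<And>Y. \<lbrakk>Y \<in> F; Y \<subseteq> X\<rbrakk> \<Longrightarrow> Y = X"
    using finite_has_minimal[of F] by metis
  then obtain e where e: "e \<in> S" "t \<in> g e" "X = g e" by (auto simp: F_def)
  have "e \<in> ra_atoms_in A S"
    unfolding ra_atoms_in_def
  proof (intro CollectI conjI ballI impI)
    show "e \<in> S" "e \<noteq> ra_zero A" using e g_zero by auto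
    fix y assume y: "y \<in> S" "ra_le A y e"
    have C: "e \<in> \<C>" "y \<in> \<C>" using e y SC by auto
    then have sub: "g y \<subseteq> g e" using y g_le by simp
    show "y = ra_zero A \<or> y = e"
    proof (cases "t \<in> g y")
      case True
      then have "g y = g e" using X(2)[of "g y"] e sub y by (auto simp: F_def)
      then show ?thesis using inj_onD[OF inj] C by auto
    next
      case False
      define z where "z = ra_meet A e (ra_cmp A y)"
      have z: "z \<in> S" "g z = g e - g y"
        using e y plus cmp C g_sub[of e] by (auto simp: z_def ra_meet_def g_plus g_cmp)
      then have "g z = g e" using X(2)[of "g z"] e False by (auto simp: F_def)
      then have "g y = {}" using z sub by auto
      then show ?thesis using g_eq_empty C by simp
    qed
  qed
  then show ?thesis using e that by blast
qed

lemma carrier_subuniverse: "is_subuniverse A \<C>"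
  using is_NA_D(2-4)[OF NA] by (auto simp: is_subuniverse_def)

text \<open>Converse reverses products, and here it is the identity.\<close>

lemma comp_comm: "\<lbrakk>x \<in> \<C>; y \<in> \<C>\<rbrakk> \<Longrightarrow> x \<odot> y = y \<odot> x"
proof -
  assume xy: "x \<in> \<C>" "y \<in> \<C>"
  then have "ra_conv A (x \<odot> y) = ra_conv A y \<odot> ra_conv A x"
    using is_NA_D(5)[OF NA xy xy(1)] by (elim conjE)
  then show ?thesis using xy by (simp add: conv_eq)
qed

lemma comp_ident: "x \<in> \<C> \<Longrightarrow> x \<odot> \<one> = x" "x \<in> \<C> \<Longrightarrow> \<one> \<odot> x = x"
proof -
  assume x: "x \<in> \<C>"
  then show "x \<odot> \<one> = x" using is_NA_D(5)[OF NA x x x] by (elim conjE)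
  then show "\<one> \<odot> x = x" using comp_comm[of x "\<one>"] x by simp
qed

lemma comp_mono_left: "\<lbrakk>x \<in> \<C>; y \<in> \<C>; z \<in> \<C>; g x \<subseteq> g y\<rbrakk> \<Longrightarrow> g (x \<odot> z) \<subseteq> g (y \<odot> z)"
proof -
  assume xyz: "x \<in> \<C>" "y \<in> \<C>" "z \<in> \<C>" "g x \<subseteq> g y"
  then have "ra_plus A x y = y" using g_le by (simp add: ra_le_def)
  moreover have "ra_plus A x y \<odot> z = ra_plus A (x \<odot> z) (y \<odot> z)"
    using is_NA_D(5)[OF NA xyz(1-3)] by (elim conjE)
  ultimately show ?thesis using g_plus[of "x \<odot> z" "y \<odot> z"] xyz by auto
qed

lemma comp_mono:
  assumes "x \<in> \<C>" "y \<in> \<C>" "z \<in> \<C>" "w \<in> \<C>" "g x \<subseteq> g y" "g z \<subseteq> g w"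
  shows "g (x \<odot> z) \<subseteq> g (y \<odot> w)"
  using comp_mono_left[of x y z] comp_mono_left[of z w y] comp_comm[of z y] comp_comm[of w y] assms by auto

text \<open>If \<open>x\<close> misses \<open>a \<odot> y\<close>, then by monotonicity
  \<open>a \<odot> x\<close> is below \<open>a \<odot> ra_cmp A (a \<odot> y)\<close>, which the
  last axiom, with \<open>a\<close> its own converse, puts below the complement of
  \<open>y\<close>.\<close>

lemma cycle_law:
  assumes "a \<in> \<C>" "x \<in> \<C>" "y \<in> \<C>" "g (a \<odot> x) \<inter> g y \<noteq> {}"
  shows "g x \<inter> g (a \<odot> y) \<noteq> {}"
proof
  assume "g x \<inter> g (a \<odot> y) = {}"
  then have "g x \<subseteq> g (ra_cmp A (a \<odot> y))" using assms g_sub[of x] by (auto simp: g_cmp)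
  then have "g (a \<odot> x) \<subseteq> g (a \<odot> ra_cmp A (a \<odot> y))" using assms by (intro comp_mono) auto
  moreover have "ra_plus A (a \<odot> ra_cmp A (a \<odot> y)) (ra_cmp A y) = ra_cmp A y"
  proof -
    have "ra_plus A (ra_comp A (ra_conv A a) (ra_cmp A (ra_comp A a y))) (ra_cmp A y) = ra_cmp A y"
      using is_NA_D(5)[OF NA assms(1,3,3)] by (elim conjE)
    then show ?thesis using assms by (simp add: conv_eq)
  qed
  then have "ra_le A (a \<odot> ra_cmp A (a \<odot> y)) (ra_cmp A y)" by (simp add: ra_le_def)
  then have "g (a \<odot> ra_cmp A (a \<odot> y)) \<subseteq> U - g y" using assms by (simp add: g_le g_cmp)
  ultimately show False using assms by blast
qed

lemma atom_le_iff:
  assumes "e \<in> ra_atoms A" "x \<in> \<C>"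
  shows "ra_le A e x \<longleftrightarrow> g e \<inter> g x \<noteq> {}"
proof -
  have "e \<in> \<C>" using assms by (simp add: ra_atoms_in_def)
  then show ?thesis
    using assms atom_dichotomy[OF carrier_subuniverse assms] atom_nonempty[OF order_refl assms(1)]
    by (auto simp: g_le)
qed

text \<open>\<open>a \<odot> \<one>\<close> meets \<open>a\<close>, so by the cycle law
  \<open>\<one>\<close> meets \<open>a \<odot> a\<close>; being an atom, it lies below.\<close>

lemma ident_le_square:
  assumes "a \<in> ra_atoms A"
  shows "ra_le A \<one> (a \<odot> a)"
proof -
  have a: "a \<in> \<C>" "g a \<noteq> {}" using assms atom_nonempty[OF order_refl] by (auto simp: ra_atoms_in_def)
  then have "g \<one> \<inter> g (a \<odot> a) \<noteq> {}" using cycle_law[of a "\<one>" a] by (simp add: comp_ident)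
  then show ?thesis using ident_atom a by (simp add: atom_le_iff)
qed

end

section \<open>Excluding embeddings into relation algebra reducts\<close>

theorem not_in_S_Ra_CA:
  fixes A :: "'a ra_alg"
  assumes NA: "is_NA A" and E: "is_subuniverse A E" "finite E"
    and Eident: "ra_ident A \<in> ra_atoms_in A E"
    and p: "card (ra_atoms_in A E) = p" "p > 3"
    and no1: "\<forall>u\<in>ra_atoms_in A E. ra_le A u (ra_diversity A) \<longrightarrow>
           ra_meet A (ra_comp A u u) u = ra_zero A"
    and fin: "finite (ra_carrier A)" and sym: "symmetric_on A (ra_carrier A)"
    and ident: "ra_ident A \<in> ra_atoms A"
    and split: "\<exists>u\<in>ra_atoms_in A E. ra_le A u (ra_diversity A) \<and>
           card {a \<in> ra_atoms A. ra_le A a u} \<ge> p ^ (p - 1)"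
  shows "\<not> in_S_Ra_CA (p + 1) A TYPE('b)"
proof
  assume "in_S_Ra_CA (p + 1) A TYPE('b)"
  then obtain D :: "'b ca_alg" and S h where CA: "is_CA (p + 1) D" and S: "sub_nr3 (p + 1) D S"
    and emb: "embeds_into_Ra A D S h"
    by (auto simp: in_S_Ra_CA_def)
  define m where "m = p + 1"
  have m: "m = p + 1" "4 < m" using p by (auto simp: m_def)
  obtain U :: "'b set set" and \<phi> c where
    cf: "cylindric_field m U (\<phi> ` ca_carrier D) c (\<lambda>i j. \<phi> (ca_diag D i j))"
    and inj: "inj_on \<phi> (ca_carrier D)"
    and plus: "\<And>x y. \<lbrakk>x \<in> ca_carrier D; y \<in> ca_carrier D\<rbrakk> \<Longrightarrow> \<phi> (ca_plus D x y) = \<phi> x \<union> \<phi> y"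
    and cmp: "\<And>x. x \<in> ca_carrier D \<Longrightarrow> \<phi> (ca_cmp D x) = U - \<phi> x"
    and cyl: "\<And>i x. \<lbrakk>i < m; x \<in> ca_carrier D\<rbrakk> \<Longrightarrow> c i (\<phi> x) = \<phi> (ca_cyl D i x)"
    using CA_representation[OF CA] m_def by metis
  interpret cylindric_field m U "\<phi> ` ca_carrier D" c "\<lambda>i j. \<phi> (ca_diag D i j)" by (rule cf)
  have clD: "\<And>x y. \<lbrakk>x \<in> ca_carrier D; y \<in> ca_carrier D\<rbrakk> \<Longrightarrow> ca_plus D x y \<in> ca_carrier D"
    "\<And>x. x \<in> ca_carrier D \<Longrightarrow> ca_cmp D x \<in> ca_carrier D"
    "\<And>i x. \<lbrakk>i < m; x \<in> ca_carrier D\<rbrakk> \<Longrightarrow> ca_cyl D i x \<in> ca_carrier D"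
    "\<And>i j. \<lbrakk>i < m; j < m\<rbrakk> \<Longrightarrow> ca_diag D i j \<in> ca_carrier D"
    unfolding m_def using is_CA_D(3-6)[OF CA] by auto
  have meetD: "ca_meet D x y \<in> ca_carrier D" "\<phi> (ca_meet D x y) = \<phi> x \<inter> \<phi> y"
    if "x \<in> ca_carrier D" "y \<in> ca_carrier D" for x y
    using that clD sub_U[of "\<phi> x"] sub_U[of "\<phi> y"] by (auto simp: ca_meet_def plus cmp)
  have subst: "ca_subst D i j x \<in> ca_carrier D" "\<phi> (ca_subst D i j x) = s i j (\<phi> x)"
    if "x \<in> ca_carrier D" "i < m" "j < m" "i \<noteq> j" for i j x
    using that clD meetD by (auto simp: ca_subst_def s_def cyl[symmetric])
  define g where "g = \<phi> \<circ> h"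
  let ?C = "ra_carrier A"
  \<comment> \<open>Invariance under coordinate 2 comes from \<open>Ra\<close>, and under the
    coordinates from 3 on from the neat reduct; together they make images of \<open>h\<close> depend
    on 0 and 1 only.\<close>
  have hC: "h x \<in> ca_carrier D" and hcyl: "\<And>k. \<lbrakk>2 \<le> k; k < m\<rbrakk> \<Longrightarrow> ca_cyl D k (h x) = h x"
    if "x \<in> ?C" for x
  proof -
    have "h x \<in> S" "ca_cyl D 2 (h x) = h x" using emb that by (auto simp: embeds_into_Ra_def)
    then show "h x \<in> ca_carrier D" "\<And>k. \<lbrakk>2 \<le> k; k < m\<rbrakk> \<Longrightarrow> ca_cyl D k (h x) = h x"
      using S m by (auto simp: sub_nr3_def nr_carrier_def subset_iff le_Suc_eq numeral_3_eq_3 numeral_2_eq_2)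
        (metis Suc_leI le_neq_implies_less)
  qed
  interpret sym_NA_rep A U g
  proof
    show "inj_on g ?C"
      using emb inj hC unfolding g_def embeds_into_Ra_def
      by (intro comp_inj_on) (auto intro: inj_on_subset)
    show "g (ra_plus A x y) = g x \<union> g y" if "x \<in> ?C" "y \<in> ?C" for x y
      using emb that hC plus by (simp add: embeds_into_Ra_def g_def)
    show "g (ra_cmp A x) = U - g x" if "x \<in> ?C" for x
      using emb that hC cmp by (simp add: embeds_into_Ra_def g_def)
    show "g x \<subseteq> U" if "x \<in> ?C" for x
      using that hC sub_U by (simp add: g_def)
  qed (use NA sym ident in auto)
  have bin: "g x \<in> binary" if "x \<in> ?C" for x
    using that hC hcyl cyl by (auto simp: binary_def g_def)
  have g_ident: "g \<one> = \<phi> (ca_diag D 0 1)" using emb by (simp add: embeds_into_Ra_def g_def)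
  \<comment> \<open>The second factor of a product is read on the pair (2,1), while \<open>T\<close>
    covers increasing pairs only. Symmetry supplies the swap: \<open>y\<close> equals its own
    converse, which is \<open>s 2 0\<close> of the label on (1,2).\<close>
  have subst_0_2: "s 0 2 (g y) = T 1 2 (g y)" if y: "y \<in> ?C" for y
  proof -
    have "h (ra_conv A y) = Ra_conv D (h y)" using emb y by (simp add: embeds_into_Ra_def)
    then have "g y = \<phi> (Ra_conv D (h y))" using y by (simp add: conv_eq g_def)
    also have "\<dots> = s 2 0 (T 1 2 (g y))"
      using hC[OF y] m subst by (simp add: Ra_conv_def T_def g_def)
    finally have "s 0 2 (g y) = s 0 2 (s 2 0 (T 1 2 (g y)))" by simp
    also have "\<dots> = T 1 2 (g y)" using bin[OF y] m by (intro s_s_back) (auto simp: c_T)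
    finally show ?thesis .
  qed
  have comp: "g (x \<odot> y) = c 2 (T 0 2 (g x) \<inter> T 1 2 (g y))" if "x \<in> ?C" "y \<in> ?C" for x y
  proof -
    have "g (x \<odot> y) = \<phi> (Ra_comp D (h x) (h y))" using emb that by (simp add: embeds_into_Ra_def g_def)
    also have "\<dots> = c 2 (s 1 2 (g x) \<inter> s 0 2 (g y))"
      using that hC m subst meetD by (simp add: Ra_comp_def g_def cyl[symmetric])
    finally show ?thesis using subst_0_2[OF that(2)] by (simp add: T_def)
  qed
  have EC: "E \<subseteq> ?C" using E by (simp add: is_subuniverse_def)
  have atE: "e \<in> E" "e \<in> ?C" if "e \<in> ra_atoms_in A E" for e using that EC by (auto simp: ra_atoms_in_def)
  have atC: "e \<in> ?C" if "e \<in> ra_atoms A" for e using that by (auto simp: ra_atoms_in_def)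
  obtain u where u: "u \<in> ra_atoms_in A E" "ra_le A u (ra_diversity A)"
      "p ^ (p - 1) \<le> card {a \<in> ra_atoms A. ra_le A a u}"
    using split by blast
  define At where "At = {a \<in> ra_atoms A. ra_le A a u}"
  define Q where "Q = ra_atoms_in A E - {\<one>}"
  have divC: "ra_diversity A \<in> ?C" by (simp add: ra_diversity_def)
  have finQ: "finite (ra_atoms_in A E)" using E by (simp add: ra_atoms_in_def)
  have AtC: "At \<subseteq> ?C" and QC: "Q \<subseteq> ?C" using atC atE by (auto simp: At_def Q_def)
  have injAt: "inj_on g At" and injQ: "inj_on g Q" using inj AtC QC by (meson sym_NA_rep.inj sym_NA_rep_axioms inj_on_subset)+
  have div: "g q \<inter> g \<one> = {}" if "q \<in> Q" for q
  proof -
    have qat: "q \<in> ra_atoms_in A E" and "q \<noteq> \<one>" using that by (auto simp: Q_def)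
    have "g q \<noteq> {}" using atom_nonempty[OF EC qat] .
    then have "q \<noteq> ra_zero A" using g_zero by metis
    then have "\<not> ra_le A q \<one>"
      using Eident qat \<open>q \<noteq> \<one>\<close> unfolding ra_atoms_in_def by blast
    then have "\<not> g q \<subseteq> g \<one>" using g_le atE(2)[OF qat] by simp
    then show ?thesis using atom_dichotomy[OF E(1) qat] atE(1)[OF Eident] by blast
  qed
  show False
  proof (rule no_splitting[of p "g ` At" "g ` Q" "g u"])
    show "m = p + 1" "4 \<le> p" using m p by auto
    show "U \<noteq> {}" using atom_nonempty[OF order_refl ident] g_sub[of "\<one>"] by auto
    show "finite (g ` At)" "g ` At \<subseteq> binary" using fin AtC bin by (auto intro: finite_subset)
    show "a \<inter> b = {}" if ab: "a \<in> g ` At" "b \<in> g ` At" "a \<noteq> b" for a b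
    proof -
      obtain x y where xy: "x \<in> At" "y \<in> At" "a = g x" "b = g y" using ab by auto
      then have "x \<in> ra_atoms A" "y \<in> ra_atoms A" by (auto simp: At_def)
      then have "g x \<subseteq> g y \<or> g x \<inter> g y = {}" "g y \<subseteq> g x \<or> g y \<inter> g x = {}"
        using atom_dichotomy[OF carrier_subuniverse] atC by auto
      then show ?thesis using ab(3) xy by blast
    qed
    show "\<phi> (ca_diag D 0 1) \<subseteq> c 2 (T 0 2 a \<inter> T 1 2 a)" if a: "a \<in> g ` At" for a
    proof -
      obtain x where x: "x \<in> ra_atoms A" "a = g x" using a by (auto simp: At_def)
      then have "g \<one> \<subseteq> g (x \<odot> x)" using ident_le_square[of x] g_le atC by simp
      then show ?thesis using comp x atC g_ident by simp
    qed
    show "finite (g ` Q)" "g ` Q \<subseteq> binary" using finQ QC bin by (auto simp: Q_def)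
    show "card (g ` Q) < p" using card_image[OF injQ] Eident finQ p by (simp add: Q_def)
    show "U \<subseteq> \<phi> (ca_diag D 0 1) \<union> \<Union> (g ` Q)"
    proof
      fix t assume "t \<in> U"
      then obtain e where "e \<in> ra_atoms_in A E" "t \<in> g e" using atom_through_point[OF E] by blast
      then show "t \<in> \<phi> (ca_diag D 0 1) \<union> \<Union> (g ` Q)" using g_ident by (cases "e = \<one>") (auto simp: Q_def)
    qed
    show "q \<inter> c 2 (T 0 2 q \<inter> T 1 2 q) = {}" if q: "q \<in> g ` Q" for q
    proof -
      obtain e where e: "e \<in> Q" "q = g e" using q by auto
      then have eC: "e \<in> ?C" using QC by auto
      have "g e \<subseteq> U - g \<one>" using div[OF e(1)] g_sub[OF eC] by blast
      then have "ra_le A e (ra_diversity A)" using eC divC by (simp add: g_le g_diversity)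
      then have "ra_meet A (e \<odot> e) e = ra_zero A" using no1 e by (simp add: Q_def)
      then have "g (e \<odot> e) \<inter> g e = {}" using g_meet[of "e \<odot> e" e] eC g_zero by simp
      then show ?thesis using comp[OF eC eC] e by auto
    qed
    have uC: "u \<in> ?C" using u atE by simp
    have "g u \<subseteq> U - g \<one>" using u uC divC by (simp add: g_le g_diversity)
    moreover have "g u \<noteq> {}" using atom_nonempty[OF EC u(1)] .
    ultimately have "u \<noteq> \<one>" by auto
    then show "g u \<in> g ` Q" using u by (simp add: Q_def)
    show "a \<subseteq> g u" if "a \<in> g ` At" for a using that uC atC by (auto simp: At_def g_le)
    show "p ^ (p - 1) \<le> card (g ` At)" using card_image[OF injAt] u by (simp add: At_def)
  qed
qed

section \<open>Basic matrices\<close>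

context sym_NA_rep
begin

section \<open>Atoms and consistent triangles\<close>

lemma atom_closed: "e \<in> ra_atoms A \<Longrightarrow> e \<in> \<C>"
  by (simp add: ra_atoms_in_def)

lemma atom_le_atom: "\<lbrakk>e \<in> ra_atoms A; f \<in> ra_atoms A; ra_le A e f\<rbrakk> \<Longrightarrow> e = f"
  using atom_nonempty[OF order_refl, of e] g_zero unfolding ra_atoms_in_def by auto

lemma ra_le_refl: "x \<in> \<C> \<Longrightarrow> ra_le A x x"
  by (simp add: g_le)

lemma ra_le_trans: "\<lbrakk>x \<in> \<C>; y \<in> \<C>; z \<in> \<C>; ra_le A x y; ra_le A y z\<rbrakk> \<Longrightarrow> ra_le A x z"
  by (auto simp: g_le)

lemma atom_le_plus:
  assumes "e \<in> ra_atoms A" "x \<in> \<C>" "y \<in> \<C>"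
  shows "ra_le A e (ra_plus A x y) \<longleftrightarrow> ra_le A e x \<or> ra_le A e y"
  using assms by (auto simp: atom_le_iff g_plus Int_Un_distrib)

lemma atom_le_cmp:
  assumes "e \<in> ra_atoms A" "x \<in> \<C>"
  shows "ra_le A e (ra_cmp A x) \<longleftrightarrow> \<not> ra_le A e x"
proof -
  have "ra_le A e (ra_cmp A x) \<longleftrightarrow> g e \<subseteq> g (ra_cmp A x)"
    using assms by (simp add: g_le atom_closed)
  also have "\<dots> \<longleftrightarrow> g e \<inter> g x = {}"
    using assms g_sub[OF atom_closed[OF assms(1)]] by (auto simp: g_cmp)
  finally show ?thesis using atom_le_iff[OF assms] by simp
qed

lemma atom_below:
  assumes fin: "finite \<C>" and "x \<in> \<C>" "t \<in> g x"
  obtains e where "e \<in> ra_atoms A" "t \<in> g e" "ra_le A e x"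
proof -
  have "t \<in> U" using assms g_sub by blast
  then obtain e where e: "e \<in> ra_atoms A" "t \<in> g e"
    using atom_through_point[OF carrier_subuniverse fin] by blast
  then have "ra_le A e x" using assms atom_le_iff[OF e(1), of x] by blast
  with e show ?thesis by (rule that)
qed

abbreviation "triangle x y z \<equiv> g x \<inter> g (y \<odot> z) \<noteq> {}"

text \<open>By commutativity and the cycle law, consistency does not depend on the order of the
  three sides.\<close>

lemma triangle_swap:
  assumes "x \<in> \<C>" "y \<in> \<C>" "z \<in> \<C>" "triangle x y z"
  shows "triangle x z y" "triangle z y x" "triangle y x z"
proof -
  show 1: "triangle x z y" using assms comp_comm[of y z] by simp
  show "triangle z y x" using cycle_law[of y z x] assms by blast
  show "triangle y x z" using cycle_law[of z y x] assms 1 comp_comm[of z x] by (auto simp: Int_commute)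
qed

text \<open>The triangle is turned so that \<open>a\<close>, and then \<open>b\<close>, stands alone
  on one side; there a common point shrinks it to an atom, after which the triangle is turned
  back.\<close>

lemma atom_le_comp_split:
  assumes fin: "finite \<C>" and x: "x \<in> ra_atoms A" and ab: "a \<in> \<C>" "b \<in> \<C>" and le: "ra_le A x (a \<odot> b)"
  obtains y z where "y \<in> ra_atoms A" "z \<in> ra_atoms A" "ra_le A y a" "ra_le A z b" "triangle x y z"
proof -
  have xC: "x \<in> \<C>" using x atom_closed by simp
  have "triangle x a b" using le x ab by (simp add: atom_le_iff)
  then have "triangle a x b" using triangle_swap xC ab by blast
  then obtain t where "t \<in> g a" "t \<in> g (x \<odot> b)" by blast
  then obtain y where y: "y \<in> ra_atoms A" "ra_le A y a" "t \<in> g y"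
    using atom_below[OF fin ab(1)] by blast
  then have yC: "y \<in> \<C>" by (simp add: atom_closed)
  have "triangle y x b" using y \<open>t \<in> g (x \<odot> b)\<close> by blast
  then have "triangle b x y" using triangle_swap xC yC ab by blast
  then obtain t' where "t' \<in> g b" "t' \<in> g (x \<odot> y)" by blast
  then obtain z where z: "z \<in> ra_atoms A" "ra_le A z b" "t' \<in> g z"
    using atom_below[OF fin ab(2)] by blast
  then have zC: "z \<in> \<C>" by (simp add: atom_closed)
  have "triangle z x y" using z \<open>t' \<in> g (x \<odot> y)\<close> by blast
  then have "triangle x y z" using triangle_swap xC yC zC by blast
  with y z that show ?thesis by blast
qed

section \<open>Three-dimensional basic matrices and their complex algebra\<close>

abbreviation "M \<equiv> basic_matrices A 3"
abbreviation "B \<equiv> Ca A 3 M"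

lemma matrixD:
  assumes "\<mu> \<in> M" "i < 3" "j < 3"
  shows "\<mu> (i, j) \<in> ra_atoms A" "\<mu> (i, j) = \<mu> (j, i)" "\<mu> (i, i) = \<one>"
    and "l < 3 \<Longrightarrow> ra_le A (\<mu> (i, j)) (\<mu> (i, l) \<odot> \<mu> (l, j))"
proof -
  have "\<mu> \<in> ({0..<3} \<times> {0..<3}) \<rightarrow>\<^sub>E ra_atoms A"
    and "ra_le A (\<mu> (i, i)) \<one>" "ra_conv A (\<mu> (i, j)) = \<mu> (j, i)"
    and 4: "l < 3 \<Longrightarrow> ra_le A (\<mu> (i, j)) (\<mu> (i, l) \<odot> \<mu> (l, j))"
    using assms by (auto simp: basic_matrices_def)
  then show 1: "\<mu> (i, j) \<in> ra_atoms A" and "\<mu> (i, j) = \<mu> (j, i)" and "\<mu> (i, i) = \<one>"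
    using assms(2,3) atom_le_atom[OF _ ident_atom, of "\<mu> (i, i)"]
    by (auto simp: PiE_iff conv_eq atom_closed)
  show "l < 3 \<Longrightarrow> ra_le A (\<mu> (i, j)) (\<mu> (i, l) \<odot> \<mu> (l, j))" by (rule 4)
qed

text \<open>An identity label on (i,j) gives \<open>\<mu> (k, i)\<close> below
  \<open>\<mu> (k, j) \<odot> \<one>\<close>, and comparable atoms are equal.\<close>

lemma matrix_ident_eq:
  assumes "\<mu> \<in> M" "i < 3" "j < 3" "k < 3" "ra_le A (\<mu> (i, j)) \<one>"
  shows "\<mu> (k, i) = \<mu> (k, j)"
proof (rule atom_le_atom)
  have "\<mu> (i, j) = \<one>" using assms matrixD(1) ident_atom by (intro atom_le_atom) auto
  then have "\<mu> (j, i) = \<one>" using matrixD(2) assms by metis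
  then show "ra_le A (\<mu> (k, i)) (\<mu> (k, j))"
    using matrixD(4)[of \<mu> k i j] assms matrixD(1)[of \<mu> k j] by (simp add: comp_ident atom_closed)
qed (use assms matrixD in auto)

text \<open>Point i is replaced by a copy of point j; this matrix is the witness for a
  substitution.\<close>

lemma matrix_subst:
  assumes "\<mu> \<in> M" "j < 3"
  shows "restrict (\<lambda>(k, l). \<mu> ((id(i := j)) k, (id(i := j)) l)) ({0..<3} \<times> {0..<3}) \<in> M"
proof -
  have "(id(i := j)) k < 3" if "k < 3" for k using that assms by simp
  then show ?thesis
    using matrixD[OF assms(1)] unfolding basic_matrices_def
    by (auto simp: conv_eq atom_closed ra_le_refl simp del: fun_upd_apply)
qed

lemma triangle_matrix:
  assumes at: "x \<in> ra_atoms A" "y \<in> ra_atoms A" "z \<in> ra_atoms A" and tri: "triangle x y z"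
  obtains \<mu> where "\<mu> \<in> M" "\<mu> (0, 1) = x" "\<mu> (0, 2) = y" "\<mu> (1, 2) = z"
proof -
  \<comment> \<open>For distinct indices below 3 the sum 1, 2 or 3 determines the unordered
    pair.\<close>
  let ?f = "\<lambda>(i, j). if i = j then \<one> else if i + j = (1::nat) then x else if i + j = 2 then y else z"
  define \<mu> where "\<mu> = restrict ?f ({0..<3} \<times> {0..<3::nat})"
  have C: "x \<in> \<C>" "y \<in> \<C>" "z \<in> \<C>" using at atom_closed by auto
  have tris: "triangle x z y" "triangle z y x" "triangle y x z" "triangle z x y" "triangle y z x"
    using triangle_swap C tri by blast+
  have le: "ra_le A x (y \<odot> z)" "ra_le A x (z \<odot> y)" "ra_le A z (y \<odot> x)"
    "ra_le A y (x \<odot> z)" "ra_le A z (x \<odot> y)" "ra_le A y (z \<odot> x)"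
    using tri tris at C by (simp_all add: atom_le_iff)
  have three: "i < 3 \<longleftrightarrow> i = 0 \<or> i = 1 \<or> i = 2" for i :: nat by auto
  have "\<mu> \<in> M"
    unfolding basic_matrices_def
  proof (intro CollectI conjI allI impI)
    show "\<mu> \<in> ({0..<3} \<times> {0..<3}) \<rightarrow>\<^sub>E ra_atoms A" using at ident_atom by (auto simp: \<mu>_def)
    fix i :: nat assume i: "i < 3"
    show "ra_le A (\<mu> (i, i)) \<one>" using i by (simp add: \<mu>_def ra_le_refl)
    fix j :: nat assume j: "j < 3"
    show "ra_conv A (\<mu> (i, j)) = \<mu> (j, i)" using i j C by (auto simp: \<mu>_def conv_eq)
    fix l :: nat assume l: "l < 3"
    have \<mu>: "\<mu> (i, j) = ?f (i, j)" "\<mu> (i, l) = ?f (i, l)" "\<mu> (l, j) = ?f (l, j)"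
      using i j l by (auto simp: \<mu>_def)
    show "ra_le A (\<mu> (i, j)) (\<mu> (i, l) \<odot> \<mu> (l, j))"
      \<comment> \<open>Triples with three different indices are the six forms in \<open>le\<close>;
        those with a repetition reduce to the identity laws or to
        \<open>ident_le_square\<close>.\<close>
      unfolding \<mu> using i j l le C at ident_le_square
      unfolding three by (elim disjE) (simp_all add: comp_ident ra_le_refl)
  qed
  moreover have "\<mu> (0, 1) = x" "\<mu> (0, 2) = y" "\<mu> (1, 2) = z" by (auto simp: \<mu>_def)
  ultimately show ?thesis by (rule that)
qed

definition edge :: "nat \<Rightarrow> nat \<Rightarrow> 'a \<Rightarrow> (nat \<times> nat \<Rightarrow> 'a) set" where
  "edge i j a = {\<mu> \<in> M. ra_le A (\<mu> (i, j)) a}"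

lemma edge_subset: "edge i j a \<subseteq> M"
  by (auto simp: edge_def)

lemma edge_sym: "\<lbrakk>i < 3; j < 3\<rbrakk> \<Longrightarrow> edge i j a = edge j i a"
  using matrixD(2) by (auto simp: edge_def)

lemma B_meet: "X \<subseteq> M \<Longrightarrow> ca_meet B X Y = X \<inter> Y"
  by (auto simp: ca_meet_def Ca_def)

lemma B_cyl_subset: "ca_cyl B i X \<subseteq> M"
  by (auto simp: Ca_def)

lemma B_cylI:
  "\<lbrakk>\<mu> \<in> M; \<mu>' \<in> X; \<And>k l. \<lbrakk>k < 3; l < 3; k \<noteq> i; l \<noteq> i\<rbrakk> \<Longrightarrow> \<mu> (k, l) = \<mu>' (k, l)\<rbrakk> \<Longrightarrow> \<mu> \<in> ca_cyl B i X"
  by (auto simp: Ca_def)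

lemma B_cylE:
  assumes "\<mu> \<in> ca_cyl B i X"
  obtains \<mu>' where "\<mu> \<in> M" "\<mu>' \<in> X" "\<And>k l. \<lbrakk>k < 3; l < 3; k \<noteq> i; l \<noteq> i\<rbrakk> \<Longrightarrow> \<mu> (k, l) = \<mu>' (k, l)"
  using assms by (auto simp: Ca_def)

lemma B_diag: "ca_diag B i j = edge i j \<one>"
  by (simp add: Ca_def edge_def)

text \<open>Substitutions carry edges to edges, so the \<open>Ra\<close> operations can be computed
  on index pairs. One inclusion uses that an identity label makes two points interchangeable, the
  other takes the matrix of \<open>matrix_subst\<close>.\<close>

lemma B_subst_edge:
  assumes "i < 3" "j < 3" "k < 3" "i \<noteq> j" "k \<noteq> i"
  shows "ca_subst B i j (edge k i a) = edge k j a"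
proof (intro equalityI subsetI)
  fix \<mu> assume "\<mu> \<in> ca_subst B i j (edge k i a)"
  then obtain \<mu>' where \<mu>: "\<mu> \<in> M" "\<mu>' \<in> edge i j \<one>" "\<mu>' \<in> edge k i a" "\<mu> (k, j) = \<mu>' (k, j)"
    using assms by (auto simp: ca_subst_def B_meet edge_subset B_diag elim!: B_cylE)
  then have "\<mu>' (k, i) = \<mu>' (k, j)" using matrix_ident_eq[of \<mu>' i j k] assms by (simp add: edge_def)
  with \<mu> show "\<mu> \<in> edge k j a" by (simp add: edge_def)
next
  fix \<mu> assume \<mu>: "\<mu> \<in> edge k j a"
  then have M: "\<mu> \<in> M" by (simp add: edge_def)
  let ?\<mu>' = "restrict (\<lambda>(k, l). \<mu> ((id(i := j)) k, (id(i := j)) l)) ({0..<3} \<times> {0..<3})"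
  have "?\<mu>' \<in> edge i j \<one> \<inter> edge k i a"
    using matrix_subst[OF M assms(2), of i] \<mu> assms matrixD(3)[OF M]
    by (auto simp: edge_def ra_le_refl)
  then show "\<mu> \<in> ca_subst B i j (edge k i a)"
    unfolding ca_subst_def B_diag B_meet[OF edge_subset] using M assms
    by (intro B_cylI[of \<mu> ?\<mu>']) auto
qed

text \<open>The three substitutions take the pair 01 to 02, 21 and finally 10, where symmetry of the
  matrices returns 01.\<close>

lemma B_Ra_conv: "Ra_conv B (edge 0 1 a) = edge 0 1 a"
  using B_subst_edge[of 1 2 0 a] B_subst_edge[of 0 1 2 a] B_subst_edge[of 2 0 1 a]
    edge_sym[of 0 2 a] edge_sym[of 2 1 a] edge_sym[of 1 0 a]
  by (simp add: Ra_conv_def)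

text \<open>One inclusion is monotonicity of the product. For the other, an atom below
  \<open>a \<odot> b\<close> extends to a consistent triangle with sides below \<open>a\<close> and
  \<open>b\<close>, whose matrix differs from the given one only at point 2.\<close>

lemma B_Ra_comp:
  assumes fin: "finite \<C>" and ab: "a \<in> \<C>" "b \<in> \<C>"
  shows "Ra_comp B (edge 0 1 a) (edge 0 1 b) = edge 0 1 (a \<odot> b)"
proof -
  have eq: "Ra_comp B (edge 0 1 a) (edge 0 1 b) = ca_cyl B 2 (edge 0 2 a \<inter> edge 1 2 b)"
    using B_subst_edge[of 1 2 0 a] B_subst_edge[of 0 2 1 b] edge_sym[of 0 1 b]
    by (simp add: Ra_comp_def B_meet edge_subset)
  show ?thesis
    unfolding eq
  proof (intro equalityI subsetI)
    fix \<mu> assume "\<mu> \<in> ca_cyl B 2 (edge 0 2 a \<inter> edge 1 2 b)"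
    then obtain \<mu>' where \<mu>: "\<mu> \<in> M" "\<mu>' \<in> M" "ra_le A (\<mu>' (0, 2)) a" "ra_le A (\<mu>' (1, 2)) b"
        "\<mu> (0, 1) = \<mu>' (0, 1)"
      by (auto simp: edge_def elim!: B_cylE)
    have at: "\<mu>' (0, 1) \<in> \<C>" "\<mu>' (0, 2) \<in> \<C>" "\<mu>' (1, 2) \<in> \<C>"
      using matrixD(1)[OF \<mu>(2)] atom_closed by auto
    have "ra_le A (\<mu>' (0, 1)) (\<mu>' (0, 2) \<odot> \<mu>' (1, 2))"
      using matrixD(4)[OF \<mu>(2), of 0 1 2] matrixD(2)[OF \<mu>(2), of 2 1] by simp
    moreover have "ra_le A (\<mu>' (0, 2) \<odot> \<mu>' (1, 2)) (a \<odot> b)"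
      using comp_mono[of "\<mu>' (0, 2)" a "\<mu>' (1, 2)" b] at ab \<mu> by (simp add: g_le)
    ultimately have "ra_le A (\<mu>' (0, 1)) (a \<odot> b)"
      using at ab ra_le_trans by (meson closed(3))
    then show "\<mu> \<in> edge 0 1 (a \<odot> b)" using \<mu> by (simp add: edge_def)
  next
    fix \<mu> assume "\<mu> \<in> edge 0 1 (a \<odot> b)"
    then have \<mu>: "\<mu> \<in> M" "ra_le A (\<mu> (0, 1)) (a \<odot> b)" by (auto simp: edge_def)
    have x: "\<mu> (0, 1) \<in> ra_atoms A" using matrixD(1)[OF \<mu>(1)] by simp
    obtain y z where yz: "y \<in> ra_atoms A" "z \<in> ra_atoms A" "ra_le A y a" "ra_le A z b" "triangle (\<mu> (0, 1)) y z"
      using atom_le_comp_split[OF fin x ab \<mu>(2)] by blast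
    then obtain \<mu>' where \<mu>': "\<mu>' \<in> M" "\<mu>' (0, 1) = \<mu> (0, 1)" "\<mu>' (0, 2) = y" "\<mu>' (1, 2) = z"
      using triangle_matrix[OF x yz(1,2,5)] by blast
    show "\<mu> \<in> ca_cyl B 2 (edge 0 2 a \<inter> edge 1 2 b)"
    proof (rule B_cylI[OF \<mu>(1)])
      show "\<mu>' \<in> edge 0 2 a \<inter> edge 1 2 b" using \<mu>' yz by (simp add: edge_def)
      fix k l :: nat assume "k < 3" "l < 3" "k \<noteq> 2" "l \<noteq> 2"
      then consider "k = l" | "k = 0" "l = 1" | "k = 1" "l = 0" by linarith
      then show "\<mu> (k, l) = \<mu>' (k, l)"
        using matrixD(3)[OF \<mu>(1), of k] matrixD(3)[OF \<mu>'(1), of k] \<mu>'(2) \<open>k < 3\<close>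
          matrixD(2)[OF \<mu>(1), of 0 1] matrixD(2)[OF \<mu>'(1), of 0 1]
        by cases auto
    qed
  qed
qed

text \<open>Every atom \<open>e\<close> occurs as an entry (0,1): the degenerate triangle with sides
  \<open>e\<close>, \<open>e\<close> and \<open>\<one>\<close> is consistent.\<close>

lemma edge_01_inj:
  assumes fin: "finite \<C>"
  shows "inj_on (edge 0 1) \<C>"
proof (rule inj_onI)
  have sub: "g a \<subseteq> g b" if "a \<in> \<C>" "b \<in> \<C>" "edge 0 1 a = edge 0 1 b" for a b
  proof
    fix t assume "t \<in> g a"
    then obtain e where e: "e \<in> ra_atoms A" "t \<in> g e" "ra_le A e a"
      using atom_below[OF fin \<open>a \<in> \<C>\<close>] by blast
    have eC: "e \<in> \<C>" using e atom_closed by simp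
    have "triangle e e \<one>" using atom_nonempty[OF order_refl e(1)] eC by (simp add: comp_ident)
    then obtain \<mu> where "\<mu> \<in> M" "\<mu> (0, 1) = e"
      using triangle_matrix[OF e(1,1) ident_atom] by blast
    then have "\<mu> \<in> edge 0 1 b" using e that by (auto simp: edge_def)
    then have "ra_le A e b" using \<open>\<mu> (0, 1) = e\<close> by (simp add: edge_def)
    then show "t \<in> g b" using e eC that by (auto simp: g_le)
  qed
  fix a b assume "a \<in> \<C>" "b \<in> \<C>" "edge 0 1 a = edge 0 1 b"
  then have "g a = g b" using sub[of a b] sub[of b a] by auto
  then show "a = b" using inj_onD[OF inj] \<open>a \<in> \<C>\<close> \<open>b \<in> \<C>\<close> by blast
qed

end

text \<open>The image of the complex algebra under \<open>h\<close> is a subalgebra of the neat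
  reduct. Since \<open>h\<close> preserves the terms defining \<open>Ra\<close>, composing it with
  \<open>edge 0 1\<close> embeds \<open>A\<close>.\<close>

theorem in_S_Nr3_CA_imp_in_S_Ra_CA:
  fixes A :: "('a, 'm) ra_alg_scheme"
  assumes NA: "is_NA A" and sym: "symmetric_on A (ra_carrier A)" and ident: "ra_ident A \<in> ra_atoms A"
    and fin: "finite (ra_carrier A)"
    and Nr: "in_S_Nr3_CA m (Ca A 3 (basic_matrices A 3)) TYPE('c)"
  shows "in_S_Ra_CA m A TYPE('c)"
proof -
  interpret H: huntington "ra_carrier A" "ra_plus A" "ra_cmp A" using NA by (rule NA_huntington)
  \<comment> \<open>\<open>A\<close> is not yet known to sit inside a cylindric algebra here, so its
    own Stone map provides the Boolean representation.\<close>
  interpret sym_NA_rep A H.maximal_ideals H.stone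
    by unfold_locales (use NA sym ident H.stone_inj H.stone_plus H.stone_neg H.stone_subset in auto)
  have carB: "ca_carrier B = Pow M" by (simp add: Ca_def)
  obtain D :: "'c ca_alg" and h where CA: "is_CA m D"
    and inj_h: "inj_on h (Pow M)"
    and nr: "\<And>x. x \<subseteq> M \<Longrightarrow> h x \<in> nr_carrier 3 m D"
    and plus: "\<And>x y. \<lbrakk>x \<subseteq> M; y \<subseteq> M\<rbrakk> \<Longrightarrow> h (ca_plus B x y) = ca_plus D (h x) (h y)"
    and cmp: "\<And>x. x \<subseteq> M \<Longrightarrow> h (ca_cmp B x) = ca_cmp D (h x)"
    and cyl: "\<And>i x. \<lbrakk>i < 3; x \<subseteq> M\<rbrakk> \<Longrightarrow> h (ca_cyl B i x) = ca_cyl D i (h x)"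
    and diag: "\<And>i j. \<lbrakk>i < 3; j < 3\<rbrakk> \<Longrightarrow> h (ca_diag B i j) = ca_diag D i j"
    using Nr unfolding in_S_Nr3_CA_def carB by auto
  have B_plus: "ca_plus B x y = x \<union> y" and B_cmp: "ca_cmp B x = M - x" for x y by (simp_all add: Ca_def)
  have meet: "h (x \<inter> y) = ca_meet D (h x) (h y)" if "x \<subseteq> M" "y \<subseteq> M" for x y
  proof -
    have "x \<inter> y = ca_cmp B (ca_plus B (ca_cmp B x) (ca_cmp B y))"
      using B_meet[OF that(1), of y] by (simp add: ca_meet_def)
    then show ?thesis using that plus cmp by (simp add: B_plus B_cmp ca_meet_def le_supI)
  qed
  have subst: "h (ca_subst B i j x) = ca_subst D i j (h x)" "ca_subst B i j x \<subseteq> M"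
    if "i < 3" "j < 3" "x \<subseteq> M" for i j x
    using that B_meet[of "edge i j \<one>" x] edge_subset[of i j "\<one>"] B_cyl_subset
      meet[of "edge i j \<one>" x] cyl[of i "edge i j \<one> \<inter> x"] diag[of i j]
    by (auto simp: ca_subst_def B_diag)
  define f where "f = h \<circ> edge 0 1"
  have "sub_nr3 m D (h ` Pow M)"
    unfolding sub_nr3_def
  proof (intro conjI ballI allI impI)
    show "h ` Pow M \<subseteq> nr_carrier 3 m D" using nr by auto
    show "ca_plus D x y \<in> h ` Pow M" if "x \<in> h ` Pow M" "y \<in> h ` Pow M" for x y
      using that plus by (auto simp: B_plus plus[symmetric])
    show "ca_cmp D x \<in> h ` Pow M" if "x \<in> h ` Pow M" for x
      using that by (auto simp: B_cmp cmp[symmetric])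
    show "ca_cyl D i x \<in> h ` Pow M" if "i < 3" "x \<in> h ` Pow M" for i x
      using that B_cyl_subset by (auto simp: cyl[symmetric])
    show "ca_diag D i j \<in> h ` Pow M" if "i < 3" "j < 3" for i j
      using that edge_subset by (auto simp: diag[symmetric] B_diag)
  qed
  moreover have "embeds_into_Ra A D (h ` Pow M) f"
    unfolding embeds_into_Ra_def
  proof (intro conjI ballI)
    show "inj_on f (ra_carrier A)"
      unfolding f_def
    proof (rule comp_inj_on[OF edge_01_inj[OF fin]])
      show "inj_on h (edge 0 1 ` ra_carrier A)"
        using inj_h by (rule inj_on_subset) (use edge_subset in blast)
    qed
    show "f x \<in> h ` Pow M" for x using edge_subset by (auto simp: f_def)
    show "ca_cyl D 2 (f x) = f x" for x
    proof -
      have "ca_cyl B 2 (edge 0 1 x) = edge 0 1 x"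
        by (auto simp: edge_def intro: B_cylI elim!: B_cylE)
      then show ?thesis using cyl[of 2 "edge 0 1 x"] edge_subset by (simp add: f_def)
    qed
    fix x assume x: "x \<in> ra_carrier A"
    have "edge 0 1 (ra_cmp A x) = M - edge 0 1 x"
      using x matrixD(1) by (auto simp: edge_def atom_le_cmp)
    then show "f (ra_cmp A x) = ca_cmp D (f x)"
      using cmp[of "edge 0 1 x"] edge_subset by (simp add: f_def B_cmp)
    have "Ra_conv D (h (edge 0 1 x)) = h (Ra_conv B (edge 0 1 x))"
      unfolding Ra_conv_def using edge_subset by (simp add: subst(2) flip: subst(1))
    then show "f (ra_conv A x) = Ra_conv D (f x)"
      using B_Ra_conv[of x] x by (simp add: f_def conv_eq)
    fix y assume y: "y \<in> ra_carrier A"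
    have "edge 0 1 (ra_plus A x y) = edge 0 1 x \<union> edge 0 1 y"
      using x y matrixD(1) by (auto simp: edge_def atom_le_plus)
    then show "f (ra_plus A x y) = ca_plus D (f x) (f y)"
      using plus[of "edge 0 1 x" "edge 0 1 y"] edge_subset by (simp add: f_def B_plus)
    have "Ra_comp D (h (edge 0 1 x)) (h (edge 0 1 y)) = h (Ra_comp B (edge 0 1 x) (edge 0 1 y))"
      unfolding Ra_comp_def using edge_subset
      by (simp add: subst(2) B_meet le_infI1 flip: subst(1) meet cyl)
    then show "f (x \<odot> y) = Ra_comp D (f x) (f y)"
      using B_Ra_comp[OF fin x y] by (simp add: f_def)
  next
    show "f \<one> = ca_diag D 0 1" using diag[of 0 1] by (simp add: f_def B_diag)
  qed
  ultimately show ?thesis using CA unfolding in_S_Ra_CA_def by blast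
qed

theorem theorem5:
  fixes A :: "'a ra_alg" and E :: "'a set" and p :: nat
  assumes "is_NA A"
    and "is_subuniverse A E"
    and "finite E" and "symmetric_on A E"
    and "ra_ident A \<in> ra_atoms_in A E"
    and "card (ra_atoms_in A E) = p" and "p > 3"
    and "\<forall>u\<in>ra_atoms_in A E. ra_le A u (ra_diversity A) \<longrightarrow>
           ra_meet A (ra_comp A u u) u = ra_zero A"
    and "finite (ra_carrier A)" and "symmetric_on A (ra_carrier A)"
    and "ra_ident A \<in> ra_atoms A"
    and "\<exists>u\<in>ra_atoms_in A E. ra_le A u (ra_diversity A) \<and>
           card {a \<in> ra_atoms A. ra_le A a u} \<ge> p ^ (p - 1)"
  shows "\<not> in_S_Ra_CA (p + 1) A TYPE('b)
    \<and> \<not> in_S_Nr3_CA (p + 1) (Ca A 3 (basic_matrices A 3)) TYPE('c)"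
  \<comment> \<open>The exclusion is taken at both carrier types, because the reduction of the neat
    reduct claim keeps the type of its cylindric algebra.\<close>
  using not_in_S_Ra_CA[OF assms(1-3,5-12), where 'b = 'b] not_in_S_Ra_CA[OF assms(1-3,5-12), where 'b = 'c]
    in_S_Nr3_CA_imp_in_S_Ra_CA[OF assms(1,10,11,9), of "p + 1", where 'c = 'c]
  by blast

end
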